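(* Let $(W,H,\mu)$ be an abstract Wiener space, let $Y$ be a real Banach space, and let $1<p<\infty$ with conjugate exponent $q$, $\frac1p+\frac1q=1$. Assume that $Y^{**}$ has the Radon–Nikodym property with respect to $\mu$. Let $\mathbf K\in L^p(\mu;L(W^*,Y^{**}))$. If there exists $\gamma>0$ such that $$\left|\,E\,\mathrm{tr}\left(\mathbf K^T\nabla^{W^*}F\right)\right|\le \gamma\left(E\|F\|_{Y^*}^q\right)^{1/q}\qquad\text{for all }F\in\mathcal S(Y^* ),$$ then $\mathbf K$ belongs to the domain $\mathbf{dom}_{p,Y^{**}}\boldsymbol\delta$ of the $Y^{**}$-valued divergence, i.e. there exists $\boldsymbol\delta\mathbf K\in L^p(\mu;Y^{**})$ such that $$E\,\mathrm{tr}\left(\mathbf K^T\nabla^{W^*}F\right)=E\left\langle \boldsymbol\delta\mathbf K,F\right\rangle\qquad\text{for all }F\in\mathcal S(Y^{***}),$$ where $\langle\cdot,\cdot\rangle$ is the duality pairing between $Y^{**}$ and $Y^{***}$.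
   Context: Abstract Wiener space: $W$ is a separable real Banach space, $H$ is a separable Hilbert space densely and continuously embedded in $W$, $\mu$ is the centered Gaussian measure on $W$ with Cameron–Martin space $H$, and $W^*\subset H\subset W$ after identifying $H^*$ with $H$. $E$ denotes expectation with respect to $\mu$. For $e\in W^*$, $\delta(e)$ denotes the Gaussian random variable $w\mapsto\langle e,w\rangle$ on $W$, which has mean $0$ and variance $|e|_H^2$. For Banach spaces $X,Z$, $L(X,Z)$ is the space of bounded linear operators from $X$ to $Z$ with the operator norm, and $L^p(\mu;X)$ is the Bochner space of ($\mu$-classes of) strongly measurable $X$-valued functions $f$ with $E\|f\|_X^p<\infty$. $X^*,X^{**},X^{***}$ are the successive duals; $Y^*$ is regarded as a subspace of $Y^{***}$ through the canonical embedding. For a Banach space $Z$, $\mathcal S(Z)$ is the set of smooth cylindrical $Z$-valued random variables, i.e. finite sums $$F=\sum_{j=1}^n \phi_j(\delta(e_1),\dots,\delta(e_m))\,z_j,$$ with $m,n\in\mathbb N$, $e_1,\dots,e_m\in W^*$ (which may be taken orthonormal in $H$), $\phi_j\in C_b^\infty(\mathbb R^m)$ (smooth, bounded together with all its derivatives) and $z_j\in Z$. For such $F$ the gradient is $$\nabla^{W^*}F=\sum_{j=1}^n\sum_{i=1}^m \partial_i\phi_j(\delta(e_1),\dots,\delta(e_m))\,e_i\otimes z_j .$$ For $\mathbf K\in L^p(\mu;L(W^*,Y^{**}))$ and $F=\sum_{j=1}^n \phi_j(\delta(e_1),\dots,\delta(e_m))\,z_j\in\mathcal S(Y^{***})$,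 with $e_1,\dots,e_m\in W^*$ orthonormal in $H$, $\phi_j\in C_b^\infty(\mathbb R^m)$ and $z_j\in Y^{***}$ (in particular for $F\in\mathcal S(Y^* )$), $\mathbf K^T$ denotes the pointwise transpose and $$\mathrm{tr}\left(\mathbf K^T\nabla^{W^*}F\right)=\sum_{j=1}^n\sum_{i=1}^m\partial_i\phi_j(\delta(e_1),\dots,\delta(e_m))\,\langle \mathbf K e_i,z_j\rangle ,$$ with $\langle\cdot,\cdot\rangle$ the pairing between $Y^{**}$ and $Y^{***}$. A Banach space $X$ has the Radon–Nikodym property with respect to $\mu$ if every countably additive $X$-valued measure $\nu$ of bounded variation on the ($\mu$-completed Borel) $\sigma$-algebra of $W$ that is absolutely continuous with respect to $\mu$ has the form $\nu(A)=\int_A g\,d\mu$ for some $g\in L^1(\mu;X)$. *)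

theory Defs
  imports "HOL-Probability.Probability"
begin

section \<open>Dual spaces\<close>

type_synonym 'x dual = "'x \<Rightarrow>\<^sub>L real"

lift_definition bidual_embed :: "'x::real_normed_vector \<Rightarrow> 'x dual dual"
  is "\<lambda>x \<phi>. blinfun_apply \<phi> x"
  by (rule blinfun.bounded_linear_left)


section \<open>Bochner spaces and the Radon--Nikodym property\<close>

text \<open>
  The Bochner integral of the library is restricted to second countable range types. The spaces
  of operators and the biduals below need not be separable, hence the following definitions.
\<close>

definition strongly_measurable :: "'a measure \<Rightarrow> ('a \<Rightarrow> 'x::real_normed_vector) \<Rightarrow> bool" where
  "strongly_measurable M f \<longleftrightarrow>
     (\<exists>s. (\<forall>n. simple_function M (s n)) \<and> (AE w in M. (\<lambda>n. s n w) \<longlonglongrightarrow> f w))"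

text \<open>Members are functions rather than classes modulo null sets.\<close>

definition bochner_Lp :: "real \<Rightarrow> 'a measure \<Rightarrow> ('a \<Rightarrow> 'x::real_normed_vector) set" where
  "bochner_Lp p M = {f. strongly_measurable M f \<and> integrable M (\<lambda>w. norm (f w) powr p)}"

definition has_bochner_value ::
  "'a measure \<Rightarrow> ('a \<Rightarrow> 'x::real_normed_vector) \<Rightarrow> 'x \<Rightarrow> bool" where
  "has_bochner_value M f x \<longleftrightarrow> strongly_measurable M f \<and>
     (\<exists>s. (\<forall>n. Bochner_Integration.simple_bochner_integrable M (s n)) \<and>
          (\<lambda>n. \<integral>\<^sup>+ w. ennreal (norm (f w - s n w)) \<partial>M) \<longlonglongrightarrow> 0 \<and>
          (\<lambda>n. Bochner_Integration.simple_bochner_integral M (s n)) \<longlonglongrightarrow> x)"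

definition countably_additive_vm :: "'a measure \<Rightarrow> ('a set \<Rightarrow> 'x::real_normed_vector) \<Rightarrow> bool" where
  "countably_additive_vm M \<nu> \<longleftrightarrow>
     (\<forall>A :: nat \<Rightarrow> 'a set. range A \<subseteq> sets M \<longrightarrow> disjoint_family A \<longrightarrow>
        (\<lambda>n. \<nu> (A n)) sums \<nu> (\<Union>n. A n))"

definition bounded_variation_vm :: "'a measure \<Rightarrow> ('a set \<Rightarrow> 'x::real_normed_vector) \<Rightarrow> bool" where
  "bounded_variation_vm M \<nu> \<longleftrightarrow>
     (\<exists>C. \<forall>P. finite P \<longrightarrow> P \<subseteq> sets M \<longrightarrow> partition_on (space M) P \<longrightarrow>
        (\<Sum>A\<in>P. norm (\<nu> A)) \<le> C)"

definition abs_continuous_vm :: "'a measure \<Rightarrow> ('a set \<Rightarrow> 'x::real_normed_vector) \<Rightarrow> bool" where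
  "abs_continuous_vm M \<nu> \<longleftrightarrow> (\<forall>A\<in>null_sets M. \<nu> A = 0)"

definition radon_nikodym_property :: "'a measure \<Rightarrow> 'x::banach itself \<Rightarrow> bool" where
  "radon_nikodym_property M _ \<longleftrightarrow>
     (\<forall>\<nu> :: 'a set \<Rightarrow> 'x.
        countably_additive_vm M \<nu> \<longrightarrow> bounded_variation_vm M \<nu> \<longrightarrow> abs_continuous_vm M \<nu> \<longrightarrow>
        (\<exists>g\<in>bochner_Lp 1 M. \<forall>A\<in>sets M. has_bochner_value M (\<lambda>w. indicator A w *\<^sub>R g w) (\<nu> A)))"


section \<open>Abstract Wiener space\<close>

text \<open>
  For the embedding \<open>\<iota>\<close> of \<open>H\<close> into \<open>W\<close>, the functional \<open>e\<close> is identified with the Riesz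
  representative in \<open>H\<close> of its restriction to \<open>H\<close>.
\<close>

definition dual_to_H ::
  "('h::real_inner \<Rightarrow>\<^sub>L 'w::real_normed_vector) \<Rightarrow> 'w dual \<Rightarrow> 'h" where
  "dual_to_H \<iota> e = (THE h. \<forall>k. h \<bullet> k = blinfun_apply e (blinfun_apply \<iota> k))"

text \<open>The library's \<open>normal_density\<close> is meaningful for positive standard deviation only.\<close>

definition centered_gaussian :: "'a measure \<Rightarrow> ('a \<Rightarrow> real) \<Rightarrow> real \<Rightarrow> bool" where
  "centered_gaussian M X \<sigma> \<longleftrightarrow>
     (if \<sigma> = 0 then X \<in> borel_measurable M \<and> (AE w in M. X w = 0)
      else distributed M lborel X (\<lambda>x. ennreal (normal_density 0 \<sigma> x)))"

text \<open>
  The last assumption says that \<open>\<mu>\<close> is centered Gaussian with covariance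
  \<open>\<langle>dual_to_H \<iota> e, dual_to_H \<iota> e'\<rangle>\<close>, i.e. that its Cameron--Martin space is \<open>H\<close>.
\<close>

locale abstract_wiener_space = prob_space \<mu>
  for \<iota> :: "'h::{real_inner, complete_space, second_countable_topology} \<Rightarrow>\<^sub>L
            'w::{banach, second_countable_topology}"
    and \<mu> :: "'w measure" +
  assumes sets_borel: "sets \<mu> = sets borel"
    and inj_embedding: "inj (blinfun_apply \<iota>)"
    and dense_embedding: "closure (range (blinfun_apply \<iota>)) = UNIV"
    and gaussian: "centered_gaussian \<mu> (blinfun_apply e) (norm (dual_to_H \<iota> e))"


section \<open>Smooth cylindrical random variables\<close>

text \<open>
  A function on \<open>\<real>\<^sup>m\<close> is encoded as a function on sequences that depends only on the coordinates
  with index below \<open>m\<close>; for such functions continuity in the product topology of the sequence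
  space is continuity on \<open>\<real>\<^sup>m\<close>.
\<close>

definition partial_deriv :: "nat \<Rightarrow> ((nat \<Rightarrow> real) \<Rightarrow> real) \<Rightarrow> (nat \<Rightarrow> real) \<Rightarrow> real" where
  "partial_deriv i \<phi> x = deriv (\<lambda>t. \<phi> (x(i := t))) (x i)"

definition Cb_infinity :: "nat \<Rightarrow> ((nat \<Rightarrow> real) \<Rightarrow> real) set" where
  "Cb_infinity m = {\<phi>.
     (\<forall>x y. (\<forall>i<m. x i = y i) \<longrightarrow> \<phi> x = \<phi> y) \<and>
     (\<forall>is\<in>lists {..<m}. let \<psi> = foldr partial_deriv is \<phi> in
        continuous_on UNIV \<psi> \<and>
        (\<exists>C. \<forall>x. \<bar>\<psi> x\<bar> \<le> C) \<and>
        (\<forall>i<m. \<forall>x. (\<lambda>t. \<psi> (x(i := t))) differentiable at (x i)))}"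

text \<open>
  \<open>Cyl m n e \<phi> z\<close> represents \<open>\<Sum>j<n. \<phi> j (\<delta>(e 0), \<dots>, \<delta>(e (m - 1))) z j\<close>; values of \<open>e\<close>, \<open>\<phi>\<close>
  and \<open>z\<close> beyond these indices are irrelevant. Only families \<open>e\<close> that are orthonormal in \<open>H\<close> are
  admitted; by Gram--Schmidt this does not restrict the class of random variables. The quantifiers
  over \<open>smooth_cyl\<close> below range over all such representations of a random variable, with the trace
  given by the formula in terms of the representation.
\<close>

datatype ('e, 'z) cyl = Cyl nat nat "nat \<Rightarrow> 'e" "nat \<Rightarrow> (nat \<Rightarrow> real) \<Rightarrow> real" "nat \<Rightarrow> 'z"

definition smooth_cyl ::
  "('h::real_inner \<Rightarrow>\<^sub>L 'w::real_normed_vector) \<Rightarrow> ('w dual, 'z::real_normed_vector) cyl set" where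
  "smooth_cyl \<iota> = {Cyl m n e \<phi> z | m n e \<phi> z.
     (\<forall>i<m. \<forall>k<m. dual_to_H \<iota> (e i) \<bullet> dual_to_H \<iota> (e k) = (if i = k then 1 else 0)) \<and>
     (\<forall>j<n. \<phi> j \<in> Cb_infinity m)}"

fun cyl_rv :: "('w dual, 'z) cyl \<Rightarrow> 'w::real_normed_vector \<Rightarrow> 'z::real_normed_vector" where
  "cyl_rv (Cyl m n e \<phi> z) w = (\<Sum>j<n. \<phi> j (\<lambda>i. blinfun_apply (e i) w) *\<^sub>R z j)"

text \<open>\<open>tr_grad T F w\<close> is the trace of \<open>T\<^sup>T \<nabla>F(w)\<close>.\<close>

fun tr_grad :: "('w dual \<Rightarrow>\<^sub>L 'x::real_normed_vector) \<Rightarrow> ('w dual, 'x dual) cyl \<Rightarrow>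
    'w::real_normed_vector \<Rightarrow> real" where
  "tr_grad T (Cyl m n e \<phi> z) w =
     (\<Sum>j<n. \<Sum>i<m. partial_deriv i (\<phi> j) (\<lambda>k. blinfun_apply (e k) w) *
        blinfun_apply (z j) (blinfun_apply T (e i)))"


section \<open>Divergence\<close>

text \<open>
  Expectations of random variables defined up to null sets are taken with respect to the
  completion of the Borel measure \<open>\<mu>\<close>.
\<close>

definition divergence_dom ::
  "real \<Rightarrow> ('h::real_inner \<Rightarrow>\<^sub>L 'w::real_normed_vector) \<Rightarrow> 'w measure \<Rightarrow>
   ('w \<Rightarrow> 'w dual \<Rightarrow>\<^sub>L 'x::banach) set" where
  "divergence_dom p \<iota> \<mu> = {K \<in> bochner_Lp p (completion \<mu>).
     \<exists>D \<in> bochner_Lp p (completion \<mu>). \<forall>F \<in> smooth_cyl \<iota>.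
       (\<integral>w. tr_grad (K w) F w \<partial>completion \<mu>) =
       (\<integral>w. blinfun_apply (cyl_rv F w) (D w) \<partial>completion \<mu>)}"

end

theory Submission
  imports Defs "HOL-Library.Function_Algebras"
begin

text \<open>
  On random variables with values in \<open>Y*\<close>, the assumed inequality says that
  \<open>\<tau> F = E tr (K\<^sup>T \<nabla>F)\<close> is bounded by \<open>\<gamma>\<close> times the \<open>L^q\<close> norm of \<open>F\<close>. By the theorem of Hahn--Banach
  (\<open>hahn_banach_cone\<close>) it extends to a linear functional \<open>l\<close> on all bounded strongly measurable functions,
  with the same bound. For this the cylindrical functions must form a vector space on which \<open>\<tau>\<close> is
  linear, which is not immediate, since two of them may involve different orthonormal families. It
  follows from a common orthonormal family (\<open>common_orthonormal\<close>), from the stability of \<open>C\<^sub>b\<^sup>\<infinity>\<close> under linear substitutions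
  (\<open>lin_subst_Cb_infinity\<close>) and from the invariance of the trace (\<open>lin_subst_trace\<close>), which together give
  \<open>smooth_cyl_add\<close>.

  The extended functional defines a \<open>Y**\<close>-valued set function \<open>\<nu>(A)(y) = l (1\<^sub>A y)\<close>. The bound on \<open>l\<close> makes
  \<open>\<nu>\<close> countably additive, absolutely continuous and of bounded variation, so that the Radon--Nikodym
  property yields a density \<open>g\<close>. Testing \<open>l\<close> with step functions adapted to \<open>g\<close> shows that \<open>g\<close> lies in
  \<open>L^p\<close> (\<open>density_Lp\<close>), and approximation of bounded functions by simple ones shows that \<open>l\<close> is
  integration against \<open>g\<close> (\<open>Lq_functional_density\<close>). In particular \<open>\<tau> F = E \<langle>g, F\<rangle>\<close> for cylindrical \<open>F\<close>
  with values in \<open>Y*\<close>.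

  For a test function \<open>\<phi>(\<delta>(e)) z\<close> with \<open>z\<close> in \<open>Y***\<close>, both sides of the claim are values of \<open>z\<close> at
  Bochner integrals in \<open>Y**\<close>. By the preceding identity these two integrals agree on every element of
  \<open>Y*\<close>, hence they are equal (\<open>integral_functional_eq_0\<close>), and \<open>g\<close> is the divergence of \<open>K\<close>.
\<close>

section \<open>Hahn--Banach extension\<close>

text \<open>
  The extension theorem below is applied to a space of functions, with pointwise operations.
\<close>

instantiation "fun" :: (type, real_vector) real_vector
begin
definition scaleR_fun where "scaleR_fun c f = (\<lambda>x. c *\<^sub>R f x)"
instance
  by standard (auto simp: scaleR_fun_def fun_eq_iff algebra_simps)
end

definition sublinear_on :: "'v::real_vector set \<Rightarrow> ('v \<Rightarrow> real) \<Rightarrow> bool" where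
  "sublinear_on C p \<longleftrightarrow> (\<forall>x\<in>C. \<forall>y\<in>C. p (x + y) \<le> p x + p y) \<and>
     (\<forall>x\<in>C. \<forall>t>0. p (t *\<^sub>R x) \<le> t * p x)"

lemma sublinear_on_zero:
  assumes "subspace C" "sublinear_on C p"
  shows "p 0 = 0"
proof -
  have 0: "0 \<in> C" using assms(1) by (rule subspace_0)
  have "p (0 + 0) \<le> p 0 + p 0" using assms(2) 0 unfolding sublinear_on_def by blast
  moreover have "p ((1/2) *\<^sub>R 0) \<le> (1/2) * p 0"
    using assms(2) 0 unfolding sublinear_on_def by (metis half_gt_zero_iff zero_less_one)
  ultimately show ?thesis by simp
qed

lemma sublinear_on_minus:
  assumes "subspace C" "sublinear_on C p" "x \<in> C"
  shows "- p (- x) \<le> p x"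
proof -
  have "p (x + - x) \<le> p x + p (- x)"
    using assms unfolding sublinear_on_def by (meson subspace_neg)
  then show ?thesis using sublinear_on_zero[OF assms(1,2)] by simp
qed

text \<open>
  The functional that sends \<open>x\<close> to the infimum of \<open>p (x + b) - r\<close> over the cone is again
  sublinear, and evaluating it at \<open>- b\<close> shows that any linear functional below it is at least \<open>r\<close> at
  \<open>b\<close>. This one construction
  serves twice: for the given cone, and, for a single ray, to show that minimal sublinear functionals
  are linear. The infimum is finite because \<open>p (x + b) - r \<ge> - p (- x)\<close>.
\<close>

lemma sublinear_on_cone:
  fixes C :: "'v::real_vector set" and B :: "('v \<times> real) set"
  assumes C: "subspace C" and p: "sublinear_on C p" and "B \<noteq> {}"
    and BC: "\<And>b r. (b, r) \<in> B \<Longrightarrow> b \<in> C"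
    and add: "\<And>b r b' r'. (b, r) \<in> B \<Longrightarrow> (b', r') \<in> B \<Longrightarrow> (b + b', r + r') \<in> B"
    and scale: "\<And>b r t. (b, r) \<in> B \<Longrightarrow> t > 0 \<Longrightarrow> (t *\<^sub>R b, t * r) \<in> B"
    and le: "\<And>b r. (b, r) \<in> B \<Longrightarrow> r \<le> p b"
  shows "\<exists>s. sublinear_on C s \<and> (\<forall>x\<in>C. \<forall>(b, r)\<in>B. s x \<le> p (x + b) - r)"
proof -
  define V where "V x = (\<lambda>(b, r). p (x + b) - r) ` B" for x
  define s where "s x = Inf (V x)" for x
  have ne: "V x \<noteq> {}" for x using \<open>B \<noteq> {}\<close> by (simp add: V_def)
  have bdd: "bdd_below (V x)" if "x \<in> C" for x
  proof (rule bdd_belowI[of _ "- p (- x)"])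
    fix v assume "v \<in> V x"
    then obtain b r where b: "(b, r) \<in> B" "v = p (x + b) - r" by (auto simp: V_def)
    have "p ((x + b) + - x) \<le> p (x + b) + p (- x)"
      using p that BC[OF b(1)] C unfolding sublinear_on_def
      by (meson subspace_add subspace_neg)
    then show "- p (- x) \<le> v" using b le[OF b(1)] by simp
  qed
  have lower: "s x \<le> p (x + b) - r" if "x \<in> C" "(b, r) \<in> B" for x b r
    unfolding s_def by (rule cInf_lower[OF _ bdd[OF that(1)]]) (use that in \<open>force simp: V_def\<close>)
  have greatest: "u \<le> s x" if "\<And>b r. (b, r) \<in> B \<Longrightarrow> u \<le> p (x + b) - r" for x u
    unfolding s_def by (rule cInf_greatest[OF ne]) (use that in \<open>auto simp: V_def\<close>)
  have "s (x + y) \<le> s x + s y" if xy: "x \<in> C" "y \<in> C" for x y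
  proof -
    have "s (x + y) - (p (y + b') - r') \<le> s x" if b': "(b', r') \<in> B" for b' r'
    proof (rule greatest)
      fix b r assume b: "(b, r) \<in> B"
      have "s (x + y) \<le> p ((x + y) + (b + b')) - (r + r')"
        using lower[OF _ add[OF b b']] xy C by (meson subspace_add)
      also have "(x + y) + (b + b') = (x + b) + (y + b')" by simp
      also have "p ((x + b) + (y + b')) \<le> p (x + b) + p (y + b')"
        using p xy BC[OF b] BC[OF b'] C unfolding sublinear_on_def by (meson subspace_add)
      finally show "s (x + y) - (p (y + b') - r') \<le> p (x + b) - r" by simp
    qed
    then have "s (x + y) - s x \<le> s y"
      by (intro greatest) (simp add: algebra_simps)
    then show ?thesis by simp
  qed
  moreover have "s (t *\<^sub>R x) \<le> t * s x" if "x \<in> C" "t > 0" for x t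
  proof -
    have "s (t *\<^sub>R x) / t \<le> s x"
    proof (rule greatest)
      fix b r assume b: "(b, r) \<in> B"
      have "s (t *\<^sub>R x) \<le> p (t *\<^sub>R x + t *\<^sub>R b) - t * r"
        using lower[OF _ scale[OF b \<open>t > 0\<close>]] that C by (meson subspace_scale)
      also have "p (t *\<^sub>R x + t *\<^sub>R b) \<le> t * p (x + b)"
        using p that BC[OF b] C unfolding sublinear_on_def
        by (metis scaleR_right_distrib subspace_add)
      finally show "s (t *\<^sub>R x) / t \<le> p (x + b) - r"
        using that by (simp add: field_simps)
    qed
    then show ?thesis using that by (simp add: field_simps)
  qed
  ultimately have "sublinear_on C s" by (auto simp: sublinear_on_def)
  then show ?thesis using lower by blast
qed

text \<open>
  Zorn's lemma, with pointwise infima as lower bounds of chains. The order is antisymmetric only for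
  functionals of which the values off \<open>C\<close> are fixed, hence the normalisation by 0 there in the proof.
\<close>

lemma sublinear_on_minimal:
  assumes C: "subspace C" and p: "sublinear_on C p"
  shows "\<exists>m. sublinear_on C m \<and> (\<forall>x\<in>C. m x \<le> p x) \<and>
    (\<forall>s. sublinear_on C s \<longrightarrow> (\<forall>x\<in>C. s x \<le> m x) \<longrightarrow> (\<forall>x\<in>C. s x = m x))"
proof -
  define A where "A = {s. sublinear_on C s \<and> (\<forall>x\<in>C. s x \<le> p x) \<and> (\<forall>x. x \<notin> C \<longrightarrow> s x = 0)}"
  define P where "P s s' \<longleftrightarrow> (\<forall>x\<in>C. s' x \<le> s x)" for s s' :: "'a \<Rightarrow> real"
  have restrict: "sublinear_on C (\<lambda>x. if x \<in> C then s x else 0)" if "sublinear_on C s" for s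
    using that C unfolding sublinear_on_def by (simp add: subspace_add subspace_scale)
  have "partial_order_on A (relation_of P A)"
  proof (rule partial_order_on_relation_ofI)
    fix s s' assume "s \<in> A" "s' \<in> A" "P s s'" "P s' s"
    then have "s x = s' x" for x
      by (cases "x \<in> C") (auto simp: A_def P_def intro: antisym)
    then show "s = s'" by blast
  next
    show "P s s''" if "P s s'" "P s' s''" for s s' s''
      using that unfolding P_def by (meson order_trans)
  qed (simp add: P_def)
  moreover have "\<exists>u\<in>A. \<forall>a\<in>D. P a u" if D: "D \<in> Chains (relation_of P A)" for D
  proof (cases "D = {}")
    case True
    have "(\<lambda>x. if x \<in> C then p x else 0) \<in> A"
      using restrict[OF p] by (auto simp: A_def)
    then show ?thesis using True by blast
  next
    case False
    have tot: "P a b \<or> P b a" if "a \<in> D" "b \<in> D" for a b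
      using D that unfolding Chains_def relation_of_def by auto
    have DA: "D \<subseteq> A" using D unfolding Chains_def relation_of_def by auto
    define u where "u x = (if x \<in> C then INF d\<in>D. d x else 0)" for x
    have bdd: "bdd_below ((\<lambda>d. d x) ` D)" if "x \<in> C" for x
    proof (rule bdd_belowI2[of _ "- p (- x)"])
      fix d assume "d \<in> D"
      then have d: "sublinear_on C d" "d (- x) \<le> p (- x)"
        using DA that C by (auto simp: A_def subspace_neg)
      then show "- p (- x) \<le> d x" using sublinear_on_minus[OF C d(1) that] by simp
    qed
    have lower: "u x \<le> d x" if "x \<in> C" "d \<in> D" for x d
      using that cINF_lower[OF bdd] by (simp add: u_def)
    have greatest: "v \<le> u x" if "x \<in> C" "\<And>d. d \<in> D \<Longrightarrow> v \<le> d x" for x v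
      using that by (auto simp: u_def intro!: cINF_greatest[OF False])
    have "u (x + y) \<le> u x + u y" if xy: "x \<in> C" "y \<in> C" for x y
    proof -
      have "u (x + y) - d' y \<le> u x" if d': "d' \<in> D" for d'
      proof (rule greatest[OF xy(1)])
        fix d assume d: "d \<in> D"
        have "\<exists>e\<in>D. e x \<le> d x \<and> e y \<le> d' y"
          using tot[OF d d'] d d' xy unfolding P_def by blast
        then obtain e where e: "e \<in> D" "e x \<le> d x" "e y \<le> d' y" by blast
        have "u (x + y) \<le> e (x + y)" using lower e(1) xy C by (meson subspace_add)
        also have "\<dots> \<le> e x + e y"
          using e(1) DA xy unfolding A_def sublinear_on_def by blast
        finally show "u (x + y) - d' y \<le> d x" using e by simp
      qed
      then have "u (x + y) - u x \<le> u y"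
        by (intro greatest[OF xy(2)]) (simp add: algebra_simps)
      then show ?thesis by simp
    qed
    moreover have "u (t *\<^sub>R x) \<le> t * u x" if "x \<in> C" "t > 0" for x t
    proof -
      have "u (t *\<^sub>R x) / t \<le> u x"
      proof (rule greatest[OF that(1)])
        fix d assume d: "d \<in> D"
        have "u (t *\<^sub>R x) \<le> d (t *\<^sub>R x)" using lower d that C by (meson subspace_scale)
        also have "\<dots> \<le> t * d x"
          using d DA that unfolding A_def sublinear_on_def by blast
        finally show "u (t *\<^sub>R x) / t \<le> d x" using that by (simp add: field_simps)
      qed
      then show ?thesis using that by (simp add: field_simps)
    qed
    ultimately have "sublinear_on C u" by (auto simp: sublinear_on_def)
    moreover have "u x \<le> p x" if "x \<in> C" for x
    proof -
      obtain d where "d \<in> D" using False by blast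
      then show ?thesis using lower[OF that] DA that unfolding A_def by fastforce
    qed
    ultimately have "u \<in> A" by (auto simp: A_def u_def)
    then show ?thesis using lower by (auto simp: P_def)
  qed
  ultimately have "\<exists>m\<in>A. \<forall>a\<in>A. P m a \<longrightarrow> a = m" by (rule predicate_Zorn)
  then obtain m where m: "m \<in> A" "\<And>a. a \<in> A \<Longrightarrow> P m a \<Longrightarrow> a = m" by blast
  have "\<forall>x\<in>C. s x = m x" if s: "sublinear_on C s" "\<forall>x\<in>C. s x \<le> m x" for s
  proof -
    let ?s = "\<lambda>x. if x \<in> C then s x else 0"
    have "?s \<in> A" using restrict[OF s(1)] s(2) m(1) unfolding A_def by fastforce
    moreover have "P m ?s" using s(2) by (simp add: P_def)
    ultimately have eq: "?s = m" by (rule m(2))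
    show ?thesis
    proof
      fix x assume "x \<in> C"
      then have "s x = ?s x" by simp
      also have "\<dots> = m x" by (rule fun_cong[OF eq])
      finally show "s x = m x" .
    qed
  qed
  then show ?thesis using m(1) unfolding A_def by blast
qed

text \<open>
  Hahn--Banach in sandwich form. The functional to be extended is given by a cone of pairs
  \<open>(vector, value)\<close> and not as a function on a subspace, so that it need not be checked beforehand
  that the value depends on the vector only. If the cone contains the negatives of its elements,
  then \<open>r \<le> l b\<close> becomes an equality.
\<close>

theorem hahn_banach_cone:
  fixes C :: "'v::real_vector set" and B :: "('v \<times> real) set"
  assumes C: "subspace C" and p: "sublinear_on C p" and "B \<noteq> {}"
    and BC: "\<And>b r. (b, r) \<in> B \<Longrightarrow> b \<in> C"
    and add: "\<And>b r b' r'. (b, r) \<in> B \<Longrightarrow> (b', r') \<in> B \<Longrightarrow> (b + b', r + r') \<in> B"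
    and scale: "\<And>b r t. (b, r) \<in> B \<Longrightarrow> t > 0 \<Longrightarrow> (t *\<^sub>R b, t * r) \<in> B"
    and le: "\<And>b r. (b, r) \<in> B \<Longrightarrow> r \<le> p b"
  shows "\<exists>l. (\<forall>x\<in>C. \<forall>y\<in>C. l (x + y) = l x + l y) \<and> (\<forall>x\<in>C. \<forall>c. l (c *\<^sub>R x) = c * l x) \<and>
    (\<forall>x\<in>C. l x \<le> p x) \<and> (\<forall>(b, r)\<in>B. r \<le> l b)"
proof -
  obtain s where s: "sublinear_on C s" and s_le: "\<And>x b r. x \<in> C \<Longrightarrow> (b, r) \<in> B \<Longrightarrow> s x \<le> p (x + b) - r"
    using sublinear_on_cone[OF C p \<open>B \<noteq> {}\<close> BC add scale le] by fastforce
  obtain l where l: "sublinear_on C l" and ls: "\<And>x. x \<in> C \<Longrightarrow> l x \<le> s x"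
    and min: "\<And>s. sublinear_on C s \<Longrightarrow> (\<forall>x\<in>C. s x \<le> l x) \<Longrightarrow> (\<forall>x\<in>C. s x = l x)"
    using sublinear_on_minimal[OF C s] by metis
  have l0: "l 0 = 0" using sublinear_on_zero[OF C l] .
  have sub: "l (x + y) \<le> l x + l y" if "x \<in> C" "y \<in> C" for x y
    using l that unfolding sublinear_on_def by blast
  have pos: "l (t *\<^sub>R x) = t * l x" if "x \<in> C" "t > 0" for x t
  proof -
    have "l (inverse t *\<^sub>R (t *\<^sub>R x)) \<le> inverse t * l (t *\<^sub>R x)"
      using l that C unfolding sublinear_on_def by (meson positive_imp_inverse_positive subspace_scale)
    then have "t * l x \<le> l (t *\<^sub>R x)" using that by (simp add: field_simps)
    moreover have "l (t *\<^sub>R x) \<le> t * l x" using l that unfolding sublinear_on_def by blast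
    ultimately show ?thesis by simp
  qed
  have super: "l x + l y \<le> l (x + y)" if xy: "x \<in> C" "y \<in> C" for x y
  proof -
    \<comment> \<open>Lowering \<open>l\<close> along the ray of \<open>y\<close> must not change it, by minimality; \<open>t = 1\<close> is then superadditivity.\<close>
    let ?B = "{(t *\<^sub>R y, t * l y) | t. t \<ge> 0}"
    have "\<exists>s. sublinear_on C s \<and> (\<forall>x\<in>C. \<forall>(b, r)\<in>?B. s x \<le> l (x + b) - r)"
    proof (rule sublinear_on_cone[OF C l])
      show "b \<in> C" if "(b, r) \<in> ?B" for b r using that xy C by (auto intro: subspace_scale)
      show "(b + b', r + r') \<in> ?B" if "(b, r) \<in> ?B" "(b', r') \<in> ?B" for b r b' r'
      proof -
        from that obtain t t' where "t \<ge> 0" "t' \<ge> 0" "b = t *\<^sub>R y" "r = t * l y" "b' = t' *\<^sub>R y" "r' = t' * l y"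
          by blast
        then show ?thesis by (auto intro!: exI[of _ "t + t'"] simp: algebra_simps)
      qed
      show "(t *\<^sub>R b, t * r) \<in> ?B" if "(b, r) \<in> ?B" "t > 0" for b r t
      proof -
        from that obtain t' where "t' \<ge> 0" "b = t' *\<^sub>R y" "r = t' * l y" by blast
        then show ?thesis using that by (auto intro!: exI[of _ "t * t'"])
      qed
      show "r \<le> l b" if "(b, r) \<in> ?B" for b r
      proof -
        from that obtain t' where "t' \<ge> 0" "b = t' *\<^sub>R y" "r = t' * l y" by blast
        then show ?thesis using pos[OF xy(2), of t'] l0 by (cases "t' = 0") auto
      qed
    qed auto
    then obtain s' where s': "sublinear_on C s'" and
      le': "\<And>x t. x \<in> C \<Longrightarrow> t \<ge> 0 \<Longrightarrow> s' x \<le> l (x + t *\<^sub>R y) - t * l y" by fastforce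
    have "\<forall>x\<in>C. s' x = l x" using le'[of _ 0] by (intro min[OF s']) simp
    then show ?thesis using le'[OF xy(1), of 1] xy by simp
  qed
  have add_eq: "l (x + y) = l x + l y" if "x \<in> C" "y \<in> C" for x y
    using sub[OF that] super[OF that] by simp
  have neg: "l (- x) = - l x" if "x \<in> C" for x
    using add_eq[OF that subspace_neg[OF C that]] l0 by simp
  have scale_eq: "l (c *\<^sub>R x) = c * l x" if "x \<in> C" for c x
  proof (cases c "0::real" rule: linorder_cases)
    case less
    have "l (c *\<^sub>R x) = l (- ((- c) *\<^sub>R x))" by simp
    also have "\<dots> = - l ((- c) *\<^sub>R x)" using neg that C by (meson subspace_scale)
    also have "\<dots> = c * l x" using pos[OF that, of "- c"] less by simp
    finally show ?thesis .
  qed (use pos[OF that] l0 in auto)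
  have B: "r \<le> l b" if b: "(b, r) \<in> B" for b r
  proof -
    have "l (- b) \<le> s (- b)" using ls BC[OF b] C by (meson subspace_neg)
    also have "\<dots> \<le> p (- b + b) - r" using s_le[OF _ b] BC[OF b] C by (meson subspace_neg)
    finally show ?thesis using neg[OF BC[OF b]] sublinear_on_zero[OF C p] by simp
  qed
  have lp: "l x \<le> p x" if "x \<in> C" for x
  proof -
    obtain b r where b: "(b, r) \<in> B" using \<open>B \<noteq> {}\<close> by auto
    have "l x \<le> p x + t" if "t > 0" for t
    proof -
      \<comment> \<open>\<open>s\<close> itself lies below \<open>p\<close>, since small multiples of an element of the cone cost arbitrarily little.\<close>
      define d where "d = t / (\<bar>p b - r\<bar> + 1)"
      have "d > 0" using \<open>t > 0\<close> by (simp add: d_def)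
      have "d * (p b - r) \<le> d * (\<bar>p b - r\<bar> + 1)" using \<open>d > 0\<close> by (intro mult_left_mono) auto
      then have d: "d > 0" "d * (p b - r) \<le> t" using \<open>d > 0\<close> by (auto simp: d_def)
      have "l x \<le> s x" using ls \<open>x \<in> C\<close> .
      also have "\<dots> \<le> p (x + d *\<^sub>R b) - d * r" using s_le[OF \<open>x \<in> C\<close> scale[OF b d(1)]] .
      also have "\<dots> \<le> p x + p (d *\<^sub>R b) - d * r"
        using p \<open>x \<in> C\<close> BC[OF scale[OF b d(1)]] unfolding sublinear_on_def by force
      also have "\<dots> \<le> p x + d * p b - d * r"
        using p BC[OF b] d(1) unfolding sublinear_on_def by force
      finally show ?thesis using d(2) by (simp add: algebra_simps)
    qed
    then show ?thesis by (rule field_le_epsilon)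
  qed
  show ?thesis using add_eq scale_eq lp B by (intro exI[of _ l]) auto
qed

section \<open>Strongly measurable functions on complete measure spaces\<close>

text \<open>
  Strong measurability only asks for convergence almost everywhere, so completeness of the measure is
  what makes norms and functionals of strongly measurable functions measurable.
\<close>

lemma (in complete_measure) borel_measurable_AE_LIMSEQ:
  fixes f :: "'a \<Rightarrow> real"
  assumes s: "\<And>n. s n \<in> borel_measurable M" and lim: "AE w in M. (\<lambda>n. s n w) \<longlonglongrightarrow> f w"
  shows "f \<in> borel_measurable M"
proof -
  obtain N where N: "{w\<in>space M. \<not> (\<lambda>n. s n w) \<longlonglongrightarrow> f w} \<subseteq> N" "N \<in> null_sets M"
    using lim by (auto elim!: AE_E)
  have [measurable]: "N \<in> sets M" using N by auto
  define h where "h w = (if w \<in> N then 0 else f w)" for w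
  have h: "h \<in> borel_measurable M"
  proof (rule borel_measurable_LIMSEQ_real)
    show "(\<lambda>w. if w \<in> N then 0 else s n w) \<in> borel_measurable M" for n
      using s[of n] by measurable
    show "(\<lambda>n. if w \<in> N then 0 else s n w) \<longlonglongrightarrow> h w" if "w \<in> space M" for w
      using N that by (auto simp: h_def)
  qed
  show ?thesis
  proof (rule measurableI)
    fix S :: "real set" assume S: "S \<in> sets borel"
    have "f -` S \<inter> N \<inter> space M \<in> null_sets M"
      by (rule complete2[OF _ N(2)]) auto
    then have "f -` S \<inter> N \<inter> space M \<in> sets M" by auto
    moreover have "h -` S \<inter> space M - N \<in> sets M" using measurable_sets[OF h S] by auto
    moreover have "f -` S \<inter> space M = (h -` S \<inter> space M - N) \<union> (f -` S \<inter> N \<inter> space M)"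
      by (auto simp: h_def)
    ultimately show "f -` S \<inter> space M \<in> sets M" by auto
  qed auto
qed

lemma strongly_measurable_simple: "simple_function M f \<Longrightarrow> strongly_measurable M f"
  unfolding strongly_measurable_def by (intro exI[of _ "\<lambda>_. f"]) auto

lemma strongly_measurable_compose2:
  assumes "strongly_measurable M f" "strongly_measurable M g"
    and h: "\<And>a b x y. a \<longlonglongrightarrow> x \<Longrightarrow> b \<longlonglongrightarrow> y \<Longrightarrow> (\<lambda>n. h (a n) (b n)) \<longlonglongrightarrow> h x y"
  shows "strongly_measurable M (\<lambda>w. h (f w) (g w))"
proof -
  obtain s where s: "\<And>n. simple_function M (s n)" "AE w in M. (\<lambda>n. s n w) \<longlonglongrightarrow> f w"
    using assms(1) by (auto simp: strongly_measurable_def)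
  obtain t where t: "\<And>n. simple_function M (t n)" "AE w in M. (\<lambda>n. t n w) \<longlonglongrightarrow> g w"
    using assms(2) by (auto simp: strongly_measurable_def)
  show ?thesis unfolding strongly_measurable_def
  proof (intro exI conjI allI)
    show "simple_function M (\<lambda>w. h (s n w) (t n w))" for n
      by (rule simple_function_compose2[OF s(1) t(1)])
    show "AE w in M. (\<lambda>n. h (s n w) (t n w)) \<longlonglongrightarrow> h (f w) (g w)"
      using s(2) t(2) by eventually_elim (rule h)
  qed
qed

lemma strongly_measurable_compose1:
  assumes "strongly_measurable M f"
    and h: "\<And>a x. a \<longlonglongrightarrow> x \<Longrightarrow> (\<lambda>n. h (a n)) \<longlonglongrightarrow> h x"
  shows "strongly_measurable M (\<lambda>w. h (f w))"
  using strongly_measurable_compose2[OF assms(1,1), of "\<lambda>x _. h x"] h by blast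

lemma strongly_measurable_const: "strongly_measurable M (\<lambda>_. c)"
  by (rule strongly_measurable_simple) simp

lemma strongly_measurable_borel:
  fixes f :: "'a \<Rightarrow> real"
  assumes "f \<in> borel_measurable M"
  shows "strongly_measurable M f"
proof -
  obtain s where "\<And>i. simple_function M (s i)" "\<And>x. x \<in> space M \<Longrightarrow> (\<lambda>i. s i x) \<longlonglongrightarrow> f x"
    using borel_measurable_implies_sequence_metric[OF assms, of 0] by metis
  then show ?thesis unfolding strongly_measurable_def by (intro exI[of _ s]) auto
qed

lemma (in complete_measure) strongly_measurable_real:
  fixes f :: "'a \<Rightarrow> real"
  assumes "strongly_measurable M f"
  shows "f \<in> borel_measurable M"
  using assms borel_measurable_AE_LIMSEQ unfolding strongly_measurable_def
  by (meson borel_measurable_simple_function)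

lemma strongly_measurable_add:
  "strongly_measurable M f \<Longrightarrow> strongly_measurable M g \<Longrightarrow> strongly_measurable M (\<lambda>w. f w + g w)"
  by (erule strongly_measurable_compose2) (auto intro: tendsto_add)

lemma strongly_measurable_diff:
  "strongly_measurable M f \<Longrightarrow> strongly_measurable M g \<Longrightarrow> strongly_measurable M (\<lambda>w. f w - g w)"
  by (erule strongly_measurable_compose2) (auto intro: tendsto_diff)

lemma strongly_measurable_scaleR:
  "f \<in> borel_measurable M \<Longrightarrow> strongly_measurable M g \<Longrightarrow> strongly_measurable M (\<lambda>w. f w *\<^sub>R g w)"
  by (drule strongly_measurable_borel, erule strongly_measurable_compose2) (auto intro: tendsto_scaleR)

lemma strongly_measurable_blinfun_apply:
  "strongly_measurable M f \<Longrightarrow> strongly_measurable M g \<Longrightarrow>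
    strongly_measurable M (\<lambda>w. blinfun_apply (f w) (g w))"
  by (erule strongly_measurable_compose2) (auto intro: blinfun.tendsto)

lemma strongly_measurable_sum:
  assumes "\<And>i. i \<in> I \<Longrightarrow> strongly_measurable M (f i)"
  shows "strongly_measurable M (\<lambda>w. \<Sum>i\<in>I. f i w)"
  using assms
proof (induction I rule: infinite_finite_induct)
  case (insert i I)
  then show ?case by (simp add: strongly_measurable_add)
qed (auto intro: strongly_measurable_const)

lemma (in complete_measure) borel_measurable_norm_strongly:
  "strongly_measurable M f \<Longrightarrow> (\<lambda>w. norm (f w)) \<in> borel_measurable M"
  by (intro strongly_measurable_real strongly_measurable_compose1[of M f norm] tendsto_norm)

section \<open>The seminorm of a Bochner space on bounded functions\<close>

locale complete_prob_space = prob_space M + complete_measure M for M :: "'a measure"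

definition bounded_strongly_measurable :: "'a measure \<Rightarrow> ('a \<Rightarrow> 'x::real_normed_vector) set" where
  "bounded_strongly_measurable M = {F. strongly_measurable M F \<and> (\<exists>c. \<forall>w. norm (F w) \<le> c)}"

definition Lq_norm :: "real \<Rightarrow> 'a measure \<Rightarrow> ('a \<Rightarrow> 'x::real_normed_vector) \<Rightarrow> real" where
  "Lq_norm q M F = (\<integral>w. norm (F w) powr q \<partial>M) powr (1 / q)"

lemma bounded_strongly_measurable_scaleR:
  assumes f: "f \<in> borel_measurable M" "\<And>w. \<bar>f w\<bar> \<le> c"
  shows "(\<lambda>w. f w *\<^sub>R z) \<in> bounded_strongly_measurable M"
proof -
  have "norm (f w *\<^sub>R z) \<le> c * norm z" for w
    using f(2)[of w] by (simp add: mult_right_mono)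
  then show ?thesis unfolding bounded_strongly_measurable_def
    using strongly_measurable_scaleR[OF f(1) strongly_measurable_const[of M z]] by blast
qed

lemma subspace_bounded_strongly_measurable:
  "subspace (bounded_strongly_measurable M)"
  unfolding subspace_def
proof (intro conjI ballI allI)
  show "0 \<in> bounded_strongly_measurable M"
    using strongly_measurable_const[of M 0] by (auto simp: bounded_strongly_measurable_def zero_fun_def)
next
  fix F G :: "'a \<Rightarrow> 'b"
  assume "F \<in> bounded_strongly_measurable M" "G \<in> bounded_strongly_measurable M"
  then obtain c d where F: "strongly_measurable M F" "\<And>w. norm (F w) \<le> c"
    and G: "strongly_measurable M G" "\<And>w. norm (G w) \<le> d"
    unfolding bounded_strongly_measurable_def by blast
  have "norm ((F + G) w) \<le> c + d" for w
    using norm_triangle_mono[OF F(2) G(2)] by simp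
  then show "F + G \<in> bounded_strongly_measurable M"
    using strongly_measurable_add[OF F(1) G(1)]
    unfolding bounded_strongly_measurable_def plus_fun_def by blast
next
  fix F :: "'a \<Rightarrow> 'b" and a
  assume "F \<in> bounded_strongly_measurable M"
  then obtain c where F: "strongly_measurable M F" "\<And>w. norm (F w) \<le> c"
    unfolding bounded_strongly_measurable_def by blast
  have "norm ((a *\<^sub>R F) w) \<le> \<bar>a\<bar> * c" for w
    using F(2)[of w] by (simp add: scaleR_fun_def mult_left_mono)
  then show "a *\<^sub>R F \<in> bounded_strongly_measurable M"
    using strongly_measurable_scaleR[OF borel_measurable_const F(1)]
    unfolding bounded_strongly_measurable_def scaleR_fun_def by blast
qed

lemma (in complete_prob_space) integrable_norm_powr:
  assumes "F \<in> bounded_strongly_measurable M" "q \<ge> 0"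
  shows "integrable M (\<lambda>w. norm (F w) powr q)"
proof -
  obtain c where F: "strongly_measurable M F" "\<And>w. norm (F w) \<le> c"
    using assms unfolding bounded_strongly_measurable_def by blast
  show ?thesis
  proof (rule integrable_const_bound)
    show "AE w in M. norm (norm (F w) powr q) \<le> c powr q"
      using F(2) \<open>q \<ge> 0\<close> by (auto intro!: powr_mono2)
    show "(\<lambda>w. norm (F w) powr q) \<in> borel_measurable M"
      using borel_measurable_norm_strongly[OF F(1)] by measurable
  qed
qed

text \<open>
  If \<open>u\<close> or \<open>v\<close> vanishes, convexity reduces to \<open>t powr q \<le> t\<close> for \<open>t\<close> between 0 and 1.
\<close>

lemma powr_convex_nonneg:
  fixes u v \<theta> q :: real
  assumes "q \<ge> 1" "0 \<le> u" "0 \<le> v" "0 < \<theta>" "\<theta> < 1"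
  shows "(\<theta> * u + (1 - \<theta>) * v) powr q \<le> \<theta> * u powr q + (1 - \<theta>) * v powr q"
proof -
  have small: "t powr q \<le> t" if "0 < t" "t < 1" for t :: real
    using that powr_mono'[of 1 q t] assms(1) by simp
  consider "u = 0" | "v = 0" | "u > 0" "v > 0" using assms by linarith
  then show ?thesis
  proof cases
    case 1
    then show ?thesis using assms small[of "1 - \<theta>"] by (simp add: powr_mult mult_right_mono)
  next
    case 2
    then show ?thesis using assms small[of \<theta>] by (simp add: powr_mult mult_right_mono)
  next
    case 3
    then show ?thesis
      using convex_onD[OF powr_convex[OF assms(1)], of "1 - \<theta>" u v] assms by simp
  qed
qed

text \<open>
  Minkowski's inequality. For \<open>\<alpha>\<close> and \<open>\<beta>\<close> above the norms of \<open>F\<close> and \<open>G\<close>, the function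
  \<open>(F + G) / (\<alpha> + \<beta>)\<close> is a convex combination of \<open>F / \<alpha>\<close> and \<open>G / \<beta>\<close>, and convexity of the power
  shows that its norm is at most 1. Strict bounds avoid the division by a vanishing norm.
\<close>

lemma (in complete_prob_space) Lq_norm_triangle:
  assumes F: "F \<in> bounded_strongly_measurable M" and G: "G \<in> bounded_strongly_measurable M"
    and q: "q \<ge> 1"
  shows "Lq_norm q M (F + G) \<le> Lq_norm q M F + Lq_norm q M G"
proof -
  have int: "integrable M (\<lambda>w. norm (H w) powr q)" if "H \<in> bounded_strongly_measurable M" for H :: "'a \<Rightarrow> 'b"
    using integrable_norm_powr[OF that] q by simp
  have FG: "F + G \<in> bounded_strongly_measurable M"
    using subspace_add[OF subspace_bounded_strongly_measurable F G] .
  have norm_powr: "Lq_norm q M H powr q = (\<integral>w. norm (H w) powr q \<partial>M)" for H :: "'a \<Rightarrow> 'b"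
    using q by (simp add: Lq_norm_def powr_powr)
  have main: "Lq_norm q M (F + G) \<le> \<alpha> + \<beta>"
    if a: "Lq_norm q M F < \<alpha>" and b: "Lq_norm q M G < \<beta>" for \<alpha> \<beta>
  proof -
    have "\<alpha> > 0" "\<beta> > 0" using a b by (auto simp: Lq_norm_def intro: le_less_trans[OF powr_ge_zero])
    define \<theta> where "\<theta> = \<alpha> / (\<alpha> + \<beta>)"
    have \<theta>: "0 < \<theta>" "\<theta> < 1" "1 - \<theta> = \<beta> / (\<alpha> + \<beta>)"
      using \<open>\<alpha> > 0\<close> \<open>\<beta> > 0\<close> by (auto simp: \<theta>_def field_simps)
    have pt: "norm ((F + G) w) powr q \<le> (\<alpha> + \<beta>) powr q *
        (\<theta> * (norm (F w) powr q / \<alpha> powr q) + (1 - \<theta>) * (norm (G w) powr q / \<beta> powr q))" for w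
    proof -
      have "norm ((F + G) w) powr q \<le> (norm (F w) + norm (G w)) powr q"
        using q by (intro powr_mono2) (auto simp: norm_triangle_ineq)
      also have "norm (F w) + norm (G w) =
          (\<alpha> + \<beta>) * (\<theta> * (norm (F w) / \<alpha>) + (1 - \<theta>) * (norm (G w) / \<beta>))"
        using \<open>\<alpha> > 0\<close> \<open>\<beta> > 0\<close> unfolding \<theta>(3) by (simp add: \<theta>_def distrib_left)
      also have "\<dots> powr q = (\<alpha> + \<beta>) powr q * (\<theta> * (norm (F w) / \<alpha>) + (1 - \<theta>) * (norm (G w) / \<beta>)) powr q"
        by (rule powr_mult)
      also have "\<dots> \<le> (\<alpha> + \<beta>) powr q *
        (\<theta> * (norm (F w) / \<alpha>) powr q + (1 - \<theta>) * (norm (G w) / \<beta>) powr q)"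
        using \<theta> \<open>\<alpha> > 0\<close> \<open>\<beta> > 0\<close> q by (intro mult_left_mono powr_convex_nonneg) auto
      finally show ?thesis using \<open>\<alpha> > 0\<close> \<open>\<beta> > 0\<close> by (simp add: powr_divide)
    qed
    have ratio: "(\<integral>w. norm (H w) powr q \<partial>M) / \<gamma> powr q \<le> 1" if "Lq_norm q M H < \<gamma>" "\<gamma> > 0"
      for H :: "'a \<Rightarrow> 'b" and \<gamma>
    proof -
      have "Lq_norm q M H powr q \<le> \<gamma> powr q"
        using that q by (intro powr_mono2) (auto simp: Lq_norm_def)
      then show ?thesis using that by (simp add: norm_powr field_simps)
    qed
    have "(\<integral>w. norm ((F + G) w) powr q \<partial>M) \<le> (\<integral>w. (\<alpha> + \<beta>) powr q *
        (\<theta> * (norm (F w) powr q / \<alpha> powr q) + (1 - \<theta>) * (norm (G w) powr q / \<beta> powr q)) \<partial>M)"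
      by (intro integral_mono pt int[OF FG] integrable_mult_right Bochner_Integration.integrable_add
          integrable_divide int[OF F] int[OF G])
    also have "\<dots> = (\<alpha> + \<beta>) powr q * (\<theta> * ((\<integral>w. norm (F w) powr q \<partial>M) / \<alpha> powr q)
        + (1 - \<theta>) * ((\<integral>w. norm (G w) powr q \<partial>M) / \<beta> powr q))"
      using int[OF F] int[OF G] by simp
    also have "\<dots> \<le> (\<alpha> + \<beta>) powr q * (\<theta> * 1 + (1 - \<theta>) * 1)"
      using \<theta> ratio[OF a \<open>\<alpha> > 0\<close>] ratio[OF b \<open>\<beta> > 0\<close>]
      by (intro mult_left_mono add_mono) auto
    finally have "(\<integral>w. norm ((F + G) w) powr q \<partial>M) \<le> (\<alpha> + \<beta>) powr q" by simp
    then have "Lq_norm q M (F + G) \<le> ((\<alpha> + \<beta>) powr q) powr (1 / q)"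
      using q unfolding Lq_norm_def by (intro powr_mono2) auto
    then show ?thesis using q \<open>\<alpha> > 0\<close> \<open>\<beta> > 0\<close> by (simp add: powr_powr)
  qed
  show ?thesis
  proof (rule field_le_epsilon)
    fix e :: real assume "e > 0"
    then show "Lq_norm q M (F + G) \<le> Lq_norm q M F + Lq_norm q M G + e"
      using main[of "Lq_norm q M F + e / 2" "Lq_norm q M G + e / 2"] by simp
  qed
qed

lemma Lq_norm_scaleR:
  assumes "q > 0" shows "Lq_norm q M (c *\<^sub>R F) = \<bar>c\<bar> * Lq_norm q M F"
proof -
  have "(\<integral>w. norm ((c *\<^sub>R F) w) powr q \<partial>M) = \<bar>c\<bar> powr q * (\<integral>w. norm (F w) powr q \<partial>M)"
    by (simp add: scaleR_fun_def powr_mult)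
  then show ?thesis using assms by (simp add: Lq_norm_def powr_mult powr_powr)
qed

lemma (in complete_prob_space) sublinear_on_Lq_norm:
  assumes "q \<ge> 1" "\<gamma> \<ge> 0"
  shows "sublinear_on (bounded_strongly_measurable M) (\<lambda>F. \<gamma> * Lq_norm q M F)"
  unfolding sublinear_on_def
proof (intro conjI ballI allI impI)
  fix F G :: "'a \<Rightarrow> 'b"
  assume "F \<in> bounded_strongly_measurable M" "G \<in> bounded_strongly_measurable M"
  from mult_left_mono[OF Lq_norm_triangle[OF this assms(1)] assms(2)]
  show "\<gamma> * Lq_norm q M (F + G) \<le> \<gamma> * Lq_norm q M F + \<gamma> * Lq_norm q M G"
    by (simp add: distrib_left)
next
  fix F :: "'a \<Rightarrow> 'b" and t :: real assume "t > 0"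
  then show "\<gamma> * Lq_norm q M (t *\<^sub>R F) \<le> t * (\<gamma> * Lq_norm q M F)"
    using assms by (simp add: Lq_norm_scaleR)
qed

section \<open>Bochner integrals and functionals\<close>

text \<open>
  Cutting the simple functions off where they exceed twice the norm of the limit makes the convergence
  dominated.
\<close>

lemma (in complete_prob_space) dominated_simple_approximation:
  fixes f :: "'a \<Rightarrow> 'x::real_normed_vector"
  assumes f: "strongly_measurable M f" and int: "integrable M (\<lambda>w. norm (f w))"
  shows "\<exists>t. (\<forall>n. simple_function M (t n)) \<and> (\<forall>n. integrable M (\<lambda>w. norm (f w - t n w))) \<and>
    (\<lambda>n. \<integral>w. norm (f w - t n w) \<partial>M) \<longlonglongrightarrow> 0"
proof -
  obtain s where s: "\<And>n. simple_function M (s n)" "AE w in M. (\<lambda>n. s n w) \<longlonglongrightarrow> f w"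
    using f by (auto simp: strongly_measurable_def)
  define t where "t n w = (if norm (s n w) \<le> 2 * norm (f w) then s n w else 0)" for n w
  have [measurable]: "(\<lambda>w. norm (f w)) \<in> borel_measurable M" using int by auto
  have [measurable]: "(\<lambda>w. norm (s n w)) \<in> borel_measurable M" for n
    by (intro borel_measurable_simple_function simple_function_compose1[OF s(1)])
  have t: "simple_function M (t n)" for n
  proof -
    have "{w. norm (s n w) \<le> 2 * norm (f w)} \<inter> space M \<in> sets M"
      by (simp add: Int_commute Int_def) measurable
    from simple_function_If_set[OF s(1)[of n] simple_function_const[of M 0] this]
    moreover have "t n = (\<lambda>w. if w \<in> {w. norm (s n w) \<le> 2 * norm (f w)} then s n w else 0)"
      by (simp add: t_def fun_eq_iff)
    ultimately show ?thesis by simp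
  qed
  have bound: "norm (f w - t n w) \<le> 3 * norm (f w)" for n w
    using norm_triangle_ineq4[of "f w" "t n w"] by (auto simp: t_def)
  have meas: "(\<lambda>w. norm (f w - t n w)) \<in> borel_measurable M" for n
    by (intro borel_measurable_norm_strongly strongly_measurable_diff f strongly_measurable_simple t)
  have lim: "AE w in M. (\<lambda>n. norm (f w - t n w)) \<longlonglongrightarrow> 0"
    using s(2)
  proof eventually_elim
    case (elim w)
    have "(\<lambda>n. t n w) \<longlonglongrightarrow> f w"
    proof (cases "f w = 0")
      case True
      then have "t n w = 0" for n by (simp add: t_def)
      then show ?thesis using True by simp
    next
      case False
      have "eventually (\<lambda>n. norm (s n w) < 2 * norm (f w)) sequentially"
        by (rule order_tendstoD(2)[OF tendsto_norm[OF elim]]) (use False in simp)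
      then have "eventually (\<lambda>n. s n w = t n w) sequentially"
        by eventually_elim (simp add: t_def)
      then show ?thesis by (rule Lim_transform_eventually[OF elim])
    qed
    from tendsto_norm[OF tendsto_diff[OF tendsto_const this, of "f w"]] show ?case by simp
  qed
  have "integrable M (\<lambda>w. norm (f w - t n w))" for n
    by (rule Bochner_Integration.integrable_bound[of M "\<lambda>w. 3 * norm (f w)"])
      (use int meas bound in auto)
  moreover have "(\<lambda>n. \<integral>w. norm (f w - t n w) \<partial>M) \<longlonglongrightarrow> (\<integral>w. 0 \<partial>M)"
    by (rule integral_dominated_convergence[where w="\<lambda>w. 3 * norm (f w)"])
      (use int meas lim bound in auto)
  ultimately show ?thesis using t by auto
qed

lemma (in complete_prob_space) has_bochner_value_functional:
  fixes f :: "'a \<Rightarrow> 'x::real_normed_vector" and \<psi> :: "'x dual"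
  assumes "has_bochner_value M f x"
  shows "has_bochner_integral M (\<lambda>w. blinfun_apply \<psi> (f w)) (blinfun_apply \<psi> x)"
proof -
  obtain s where f: "strongly_measurable M f"
    and s: "\<And>n. Bochner_Integration.simple_bochner_integrable M (s n)"
    and lim: "(\<lambda>n. \<integral>\<^sup>+ w. ennreal (norm (f w - s n w)) \<partial>M) \<longlonglongrightarrow> 0"
    and val: "(\<lambda>n. Bochner_Integration.simple_bochner_integral M (s n)) \<longlonglongrightarrow> x"
    using assms unfolding has_bochner_value_def by blast
  have sm: "simple_function M (s n)" for n
    using s by (auto elim: simple_bochner_integrable.cases)
  show ?thesis
  proof (rule has_bochner_integral.intros)
    show "(\<lambda>w. blinfun_apply \<psi> (f w)) \<in> borel_measurable M"
      by (intro strongly_measurable_real strongly_measurable_blinfun_apply strongly_measurable_const f)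
    show "Bochner_Integration.simple_bochner_integrable M (\<lambda>w. blinfun_apply \<psi> (s n w))" for n
      using simple_bochner_integrable_compose2[of "\<lambda>a _. blinfun_apply \<psi> a" M "s n" "s n"] s by simp
    show "(\<lambda>n. \<integral>\<^sup>+ w. ennreal (norm (blinfun_apply \<psi> (f w) - blinfun_apply \<psi> (s n w))) \<partial>M) \<longlonglongrightarrow> 0"
    proof (rule tendsto_sandwich[OF _ _ tendsto_const])
      show "eventually (\<lambda>n. (\<integral>\<^sup>+ w. ennreal (norm (blinfun_apply \<psi> (f w) - blinfun_apply \<psi> (s n w))) \<partial>M)
          \<le> ennreal (norm \<psi>) * (\<integral>\<^sup>+ w. ennreal (norm (f w - s n w)) \<partial>M)) sequentially"
      proof (intro always_eventually allI)
        fix n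
        have "(\<integral>\<^sup>+ w. ennreal (norm (blinfun_apply \<psi> (f w) - blinfun_apply \<psi> (s n w))) \<partial>M)
          \<le> (\<integral>\<^sup>+ w. ennreal (norm \<psi>) * ennreal (norm (f w - s n w)) \<partial>M)"
          by (intro nn_integral_mono)
            (auto simp flip: ennreal_mult blinfun.diff_right intro!: ennreal_leI norm_blinfun[of \<psi>, simplified])
        also have "\<dots> = ennreal (norm \<psi>) * (\<integral>\<^sup>+ w. ennreal (norm (f w - s n w)) \<partial>M)"
        proof (rule nn_integral_cmult)
          show "(\<lambda>w. ennreal (norm (f w - s n w))) \<in> borel_measurable M"
            by (intro measurable_compose[OF borel_measurable_norm_strongly measurable_ennreal]
                strongly_measurable_diff strongly_measurable_simple f sm)
        qed
        finally show "(\<integral>\<^sup>+ w. ennreal (norm (blinfun_apply \<psi> (f w) - blinfun_apply \<psi> (s n w))) \<partial>M)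
          \<le> ennreal (norm \<psi>) * (\<integral>\<^sup>+ w. ennreal (norm (f w - s n w)) \<partial>M)" .
      qed
      show "(\<lambda>n. ennreal (norm \<psi>) * (\<integral>\<^sup>+ w. ennreal (norm (f w - s n w)) \<partial>M)) \<longlonglongrightarrow> 0"
        using ennreal_tendsto_cmult[OF _ lim, of "ennreal (norm \<psi>)"] by simp
    qed simp
    have "Bochner_Integration.simple_bochner_integral M (\<lambda>w. blinfun_apply \<psi> (s n w))
        = blinfun_apply \<psi> (Bochner_Integration.simple_bochner_integral M (s n))" for n
      by (rule simple_bochner_integral_linear[OF _ s])
        (rule bounded_linear.linear[OF blinfun.bounded_linear_right])
    then show "(\<lambda>n. Bochner_Integration.simple_bochner_integral M (\<lambda>w. blinfun_apply \<psi> (s n w)))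
        \<longlonglongrightarrow> blinfun_apply \<psi> x"
      using blinfun.tendsto[OF tendsto_const val] by simp
  qed
qed

text \<open>
  A strongly measurable function that is integrable has a Bochner integral, and the elements of \<open>'z\<close>
  separate the points of its dual; hence weak* vanishing of the integral implies that
  it vanishes as an element of the dual space. This is what carries the integration by parts from test
  functions with values in \<open>'z\<close> to those with values in the bidual of \<open>'z\<close>.
\<close>

lemma (in complete_prob_space) integral_functional_eq_0:
  fixes f :: "'a \<Rightarrow> 'z::real_normed_vector dual" and \<psi> :: "'z dual dual"
  assumes f: "strongly_measurable M f" and int: "integrable M (\<lambda>w. norm (f w))"
    and zero: "\<And>z. (\<integral>w. blinfun_apply (f w) z \<partial>M) = 0"
  shows "(\<integral>w. blinfun_apply \<psi> (f w) \<partial>M) = 0"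
proof -
  obtain t where t: "\<And>n. simple_function M (t n)"
    and t_int: "\<And>n. integrable M (\<lambda>w. norm (f w - t n w))"
    and lim: "(\<lambda>n. \<integral>w. norm (f w - t n w) \<partial>M) \<longlonglongrightarrow> 0"
    using dominated_simple_approximation[OF f int] by blast
  define d where "d n = (\<integral>w. norm (f w - t n w) \<partial>M)" for n
  have sb: "Bochner_Integration.simple_bochner_integrable M (t n)" for n
    by (rule simple_bochner_integrable.intros[OF t]) simp
  define I where "I n = Bochner_Integration.simple_bochner_integral M (t n)" for n
  have diff: "\<bar>(\<integral>w. \<Phi> (f w) \<partial>M) - \<Phi> (I n)\<bar> \<le> c * d n"
    if \<Phi>: "bounded_linear \<Phi>" and c: "\<And>x. \<bar>\<Phi> x\<bar> \<le> c * norm x" for \<Phi> :: "'z dual \<Rightarrow> real" and c n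
  proof -
    interpret bounded_linear \<Phi> by (rule \<Phi>)
    have sb': "Bochner_Integration.simple_bochner_integrable M (\<lambda>w. \<Phi> (t n w))"
      using simple_bochner_integrable_compose2[of "\<lambda>a _. \<Phi> a" M "t n" "t n"] sb zero by simp
    have "has_bochner_integral M (\<lambda>w. \<Phi> (t n w)) (\<Phi> (I n))"
      using has_bochner_integral_simple_bochner_integrable[OF sb']
        simple_bochner_integral_linear[OF linear_axioms sb] by (simp add: I_def)
    then have 1: "integrable M (\<lambda>w. \<Phi> (t n w))" "(\<integral>w. \<Phi> (t n w) \<partial>M) = \<Phi> (I n)"
      by (auto simp: has_bochner_integral_iff)
    have "(\<lambda>w. \<Phi> (f w)) \<in> borel_measurable M"
      by (intro strongly_measurable_real strongly_measurable_compose1[OF f] tendsto)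
    then have 2: "integrable M (\<lambda>w. \<Phi> (f w))"
      by (rule Bochner_Integration.integrable_bound[of M "\<lambda>w. c * norm (f w)", rotated])
        (use int c in \<open>auto intro: order_trans[OF _ abs_ge_self]\<close>)
    have "\<bar>\<integral>w. \<Phi> (f w) - \<Phi> (t n w) \<partial>M\<bar> \<le> (\<integral>w. c * norm (f w - t n w) \<partial>M)"
    proof (rule order_trans[OF integral_abs_bound integral_mono])
      show "integrable M (\<lambda>w. \<bar>\<Phi> (f w) - \<Phi> (t n w)\<bar>)" using 1 2 by auto
      show "integrable M (\<lambda>w. c * norm (f w - t n w))" using t_int by simp
      show "\<bar>\<Phi> (f w) - \<Phi> (t n w)\<bar> \<le> c * norm (f w - t n w)" for w
        using c[of "f w - t n w"] by (simp add: local.diff)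
    qed
    then show "\<bar>(\<integral>w. \<Phi> (f w) \<partial>M) - \<Phi> (I n)\<bar> \<le> c * d n"
      using 1 2 by (simp add: d_def)
  qed
  have d0: "d n \<ge> 0" for n by (simp add: d_def)
  have normI: "norm (I n) \<le> d n" for n
  proof (rule norm_blinfun_bound[OF d0])
    fix z
    have "\<bar>blinfun_apply x z\<bar> \<le> norm z * norm x" for x :: "'z dual"
      using norm_blinfun[of x z] by (simp add: mult.commute)
    from diff[OF blinfun.bounded_linear_left[of z] this]
    show "norm (blinfun_apply (I n) z) \<le> d n * norm z" by (simp add: zero mult.commute)
  qed
  have "\<bar>\<integral>w. blinfun_apply \<psi> (f w) \<partial>M\<bar> \<le> 2 * norm \<psi> * d n" for n
  proof -
    have "\<bar>blinfun_apply \<psi> x\<bar> \<le> norm \<psi> * norm x" for x using norm_blinfun[of \<psi> x] by simp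
    from diff[OF blinfun.bounded_linear_right this]
    have "\<bar>(\<integral>w. blinfun_apply \<psi> (f w) \<partial>M) - blinfun_apply \<psi> (I n)\<bar> \<le> norm \<psi> * d n" .
    moreover have "\<bar>blinfun_apply \<psi> (I n)\<bar> \<le> norm \<psi> * d n"
      using norm_blinfun[of \<psi> "I n"] mult_left_mono[OF normI norm_ge_zero[of \<psi>], of n] by simp
    ultimately show ?thesis by linarith
  qed
  moreover have "(\<lambda>n. 2 * norm \<psi> * d n) \<longlonglongrightarrow> 2 * norm \<psi> * 0"
    using lim unfolding d_def by (intro tendsto_mult_left)
  ultimately have "\<bar>\<integral>w. blinfun_apply \<psi> (f w) \<partial>M\<bar> \<le> 0"
    by (intro LIMSEQ_le_const[of _ "0::real"]) auto
  then show ?thesis by simp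
qed

text \<open>
  The norm of a functional need not be attained on the unit ball; the factor 2 leaves room for that.
\<close>

lemma norming_vector:
  fixes v :: "'z::real_normed_vector dual"
  shows "\<exists>y. norm y \<le> 1 \<and> norm v / 2 \<le> blinfun_apply v y"
proof (cases "v = 0")
  case False
  have "\<exists>z. norm v / 2 * norm z < \<bar>blinfun_apply v z\<bar>"
  proof (rule ccontr)
    assume "\<not> ?thesis"
    then have "norm v \<le> norm v / 2" by (intro norm_blinfun_bound) (auto simp: not_less)
    then show False using False by simp
  qed
  then obtain z where z: "norm v / 2 * norm z < \<bar>blinfun_apply v z\<bar>" by blast
  then have "z \<noteq> 0" by auto
  define y where "y = (sgn (blinfun_apply v z) / norm z) *\<^sub>R z"
  have "norm y \<le> 1" using \<open>z \<noteq> 0\<close> by (simp add: y_def abs_sgn_eq)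
  moreover have "blinfun_apply v y = \<bar>blinfun_apply v z\<bar> / norm z"
    by (simp add: y_def blinfun.scaleR_right abs_sgn mult.commute)
  moreover have "norm v / 2 < \<bar>blinfun_apply v z\<bar> / norm z"
    using z \<open>z \<noteq> 0\<close> by (subst pos_less_divide_eq) auto
  ultimately show ?thesis by (intro exI[of _ y]) simp
qed (auto intro: exI[of _ 0])

section \<open>Functionals on Bochner spaces and the Radon--Nikodym property\<close>

text \<open>
  Under the Radon--Nikodym property of the dual of \<open>'z\<close>, such a functional is given by an \<open>L^p\<close>
  density with values in that dual. Bounded functions suffice as a domain, since the step functions and
  the cylindrical random variables are among them.
\<close>

locale Lq_functional = complete_prob_space M for M :: "'a measure" +
  fixes l :: "('a \<Rightarrow> 'z::real_normed_vector) \<Rightarrow> real" and \<gamma> p q :: real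
  assumes space_UNIV: "space M = UNIV"
    and l_add: "F \<in> bounded_strongly_measurable M \<Longrightarrow> G \<in> bounded_strongly_measurable M \<Longrightarrow>
      l (F + G) = l F + l G"
    and l_scale: "F \<in> bounded_strongly_measurable M \<Longrightarrow> l (c *\<^sub>R F) = c * l F"
    and l_le: "F \<in> bounded_strongly_measurable M \<Longrightarrow> l F \<le> \<gamma> * Lq_norm q M F"
    and \<gamma>: "\<gamma> \<ge> 0" and p: "p > 1" and pq: "1 / p + 1 / q = 1"
begin

lemma q: "q > 1"
proof -
  have "0 < 1 / p" "1 / p < 1" using p by auto
  then have "0 < 1 / q" "1 / q < 1" using pq by linarith+
  then show ?thesis by (simp add: divide_less_eq_1)
qed

lemma conjugate: "(p - 1) * q = p"
  using pq p q by (simp add: field_simps)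

lemma l_abs:
  assumes F: "F \<in> bounded_strongly_measurable M"
  shows "\<bar>l F\<bar> \<le> \<gamma> * Lq_norm q M F"
proof -
  have "l ((-1) *\<^sub>R F) \<le> \<gamma> * Lq_norm q M ((-1) *\<^sub>R F)"
    by (rule l_le[OF subspace_scale[OF subspace_bounded_strongly_measurable F]])
  then have "- l F \<le> \<gamma> * Lq_norm q M F"
    unfolding l_scale[OF F] using q by (subst (asm) Lq_norm_scaleR) auto
  then show ?thesis using l_le[OF F] by simp
qed

lemma l_sum:
  assumes "finite I" "\<And>i. i \<in> I \<Longrightarrow> F i \<in> bounded_strongly_measurable M"
  shows "(\<lambda>w. \<Sum>i\<in>I. F i w) \<in> bounded_strongly_measurable M \<and> l (\<lambda>w. \<Sum>i\<in>I. F i w) = (\<Sum>i\<in>I. l (F i))"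
  using assms
proof (induction I rule: finite_induct)
  case empty
  have "(0 :: 'a \<Rightarrow> 'z) \<in> bounded_strongly_measurable M"
    by (rule subspace_0[OF subspace_bounded_strongly_measurable])
  then show ?case using l_scale[of 0 0] by (simp add: zero_fun_def)
next
  case (insert i I)
  have "(\<lambda>w. \<Sum>i\<in>insert i I. F i w) = F i + (\<lambda>w. \<Sum>i\<in>I. F i w)"
    using insert by (simp add: fun_eq_iff)
  moreover have "F i \<in> bounded_strongly_measurable M"
    and "(\<lambda>w. \<Sum>i\<in>I. F i w) \<in> bounded_strongly_measurable M"
    and "l (\<lambda>w. \<Sum>i\<in>I. F i w) = (\<Sum>i\<in>I. l (F i))"
    using insert by auto
  ultimately show ?case
    using subspace_add[OF subspace_bounded_strongly_measurable, of "F i" M] insert(1,2) by (simp add: l_add)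
qed

definition ind :: "'a set \<Rightarrow> 'z \<Rightarrow> 'a \<Rightarrow> 'z" where "ind A z = (\<lambda>w. indicator A w *\<^sub>R z)"

lemma ind_bounded: "A \<in> sets M \<Longrightarrow> ind A z \<in> bounded_strongly_measurable M"
  unfolding ind_def by (rule bounded_strongly_measurable_scaleR[where c=1]) (auto simp: indicator_def)

lemma l_ind_le:
  assumes "A \<in> sets M"
  shows "\<bar>l (ind A z)\<bar> \<le> \<gamma> * prob A powr (1 / q) * norm z"
proof -
  have "norm (ind A z w) powr q = norm z powr q * indicator A w" for w
    using q by (auto simp: ind_def indicator_def)
  then have "Lq_norm q M (ind A z) = norm z * prob A powr (1 / q)"
    using q assms by (simp add: Lq_norm_def powr_mult powr_powr)
  then show ?thesis using l_abs[OF ind_bounded[OF assms], of z] by (simp add: mult_ac)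
qed

text \<open>
  The vector measure of which the Radon--Nikodym density represents the functional. On sets that are
  not measurable its values are arbitrary.
\<close>

definition rep_measure :: "'a set \<Rightarrow> 'z dual" where "rep_measure A = Blinfun (\<lambda>z. l (ind A z))"

lemma rep_measure_apply:
  assumes A: "A \<in> sets M" shows "blinfun_apply (rep_measure A) z = l (ind A z)"
proof -
  have "bounded_linear (\<lambda>z. l (ind A z))"
  proof
    show "l (ind A (x + y)) = l (ind A x) + l (ind A y)" for x y
      using l_add[OF ind_bounded[OF A] ind_bounded[OF A], of x y]
      by (simp add: ind_def plus_fun_def scaleR_add_right)
    show "l (ind A (r *\<^sub>R x)) = r *\<^sub>R l (ind A x)" for r x
      using l_scale[OF ind_bounded[OF A], of r x] by (simp add: ind_def scaleR_fun_def mult.commute)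
    show "\<exists>K. \<forall>x. norm (l (ind A x)) \<le> norm x * K"
      using l_ind_le[OF A] by (intro exI[of _ "\<gamma> * prob A powr (1 / q)"]) (auto simp: mult.commute)
  qed
  then show ?thesis by (simp add: rep_measure_def bounded_linear_Blinfun_apply)
qed

lemma norm_rep_measure:
  assumes "A \<in> sets M" shows "norm (rep_measure A) \<le> \<gamma> * prob A powr (1 / q)"
  using l_ind_le[OF assms] \<gamma> by (intro norm_blinfun_bound) (auto simp: rep_measure_apply[OF assms])

lemma rep_measure_Un:
  assumes "A \<in> sets M" "B \<in> sets M" "A \<inter> B = {}"
  shows "rep_measure (A \<union> B) = rep_measure A + rep_measure B"
proof (rule blinfun_eqI)
  fix z
  have "ind (A \<union> B) z = ind A z + ind B z"
    using assms(3) by (auto simp: ind_def fun_eq_iff indicator_def)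
  then show "blinfun_apply (rep_measure (A \<union> B)) z = blinfun_apply (rep_measure A + rep_measure B) z"
    using assms l_add[OF ind_bounded ind_bounded] by (simp add: rep_measure_apply blinfun.add_left)
qed

lemma rep_measure_empty: "rep_measure {} = 0"
  using norm_rep_measure[of "{}"] by simp

lemma rep_measure_countably_additive: "countably_additive_vm M rep_measure"
  unfolding countably_additive_vm_def
proof (intro allI impI)
  fix A :: "nat \<Rightarrow> 'a set"
  assume A: "range A \<subseteq> sets M" and disj: "disjoint_family A"
  have fin: "rep_measure (\<Union>i<n. A i) = (\<Sum>i<n. rep_measure (A i))" for n
  proof (induction n)
    case (Suc n)
    have "A i \<inter> A n = {}" if "i < n" for i
      using disjoint_family_onD[OF disj, of i n] that by simp
    then have "(\<Union>i<n. A i) \<inter> A n = {}" by blast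
    then have "rep_measure ((\<Union>i<n. A i) \<union> A n) = rep_measure (\<Union>i<n. A i) + rep_measure (A n)"
      using A by (intro rep_measure_Un) auto
    moreover have "(\<Union>i<Suc n. A i) = (\<Union>i<n. A i) \<union> A n" by (auto simp: less_Suc_eq)
    ultimately show ?case using Suc by simp
  qed (simp add: rep_measure_empty)
  define R where "R n = (\<Union>i. A i) - (\<Union>i<n. A i)" for n
  have R: "R n \<in> sets M" for n using A by (auto simp: R_def)
  have split: "rep_measure (\<Union>i. A i) - (\<Sum>i<n. rep_measure (A i)) = rep_measure (R n)" for n
  proof -
    have "rep_measure ((\<Union>i<n. A i) \<union> R n) = rep_measure (\<Union>i<n. A i) + rep_measure (R n)"
      using A R by (intro rep_measure_Un) (auto simp: R_def)
    moreover have "(\<Union>i<n. A i) \<union> R n = (\<Union>i. A i)" by (auto simp: R_def)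
    ultimately show ?thesis by (simp add: fin)
  qed
  have "(\<lambda>n. prob (R n)) \<longlonglongrightarrow> prob (\<Inter>n. R n)"
    using R by (intro finite_Lim_measure_decseq) (force simp: decseq_def R_def)+
  moreover have "(\<Inter>n. R n) = {}" by (auto simp: R_def)
  ultimately have "(\<lambda>n. prob (R n)) \<longlonglongrightarrow> 0" by simp
  then have "(\<lambda>n. prob (R n) powr (1 / q)) \<longlonglongrightarrow> 0 powr (1 / q)"
    using q by (intro tendsto_powr') auto
  then have "(\<lambda>n. \<gamma> * prob (R n) powr (1 / q)) \<longlonglongrightarrow> 0"
    using tendsto_mult_right_zero by auto
  then have "(\<lambda>n. rep_measure (R n)) \<longlonglongrightarrow> 0"
    by (rule Lim_null_comparison[rotated]) (use norm_rep_measure[OF R] in auto)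
  then have "(\<lambda>n. rep_measure (\<Union>i. A i) - (\<Sum>i<n. rep_measure (A i))) \<longlonglongrightarrow> 0" by (simp add: split)
  from tendsto_diff[OF tendsto_const[of "rep_measure (\<Union>i. A i)"] this]
  show "(\<lambda>n. rep_measure (A n)) sums rep_measure (\<Union>n. A n)" by (simp add: sums_def)
qed

lemma rep_measure_abs_continuous: "abs_continuous_vm M rep_measure"
  unfolding abs_continuous_vm_def
proof
  fix A assume "A \<in> null_sets M"
  then have "A \<in> sets M" "prob A = 0" by (auto simp: measure_eq_0_null_sets)
  then show "rep_measure A = 0" using norm_rep_measure[of A] by simp
qed

text \<open>
  For a norming vector \<open>y A\<close> of each piece, half of the variation is at most the value of the functional
  at the step function \<open>\<Sum>A\<in>P. 1\<^sub>A y A\<close>. That function is bounded by 1, whence so is its \<open>L^q\<close> norm.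
\<close>

lemma rep_measure_bounded_variation: "bounded_variation_vm M rep_measure"
  unfolding bounded_variation_vm_def
proof (intro exI[of _ "2 * \<gamma>"] allI impI)
  fix P assume P: "finite P" "P \<subseteq> sets M" "partition_on (space M) P"
  obtain y where y: "\<And>A. norm (y A) \<le> 1" "\<And>A. norm (rep_measure A) / 2 \<le> blinfun_apply (rep_measure A) (y A)"
    using norming_vector[of "rep_measure _"] by metis
  let ?F = "\<lambda>w. \<Sum>A\<in>P. ind A (y A) w"
  have F: "?F \<in> bounded_strongly_measurable M" and lF: "l ?F = (\<Sum>A\<in>P. l (ind A (y A)))"
    using l_sum[OF P(1), of "\<lambda>A. ind A (y A)"] P(2) ind_bounded by auto
  have "norm (?F w) \<le> 1" for w
  proof -
    obtain B where B: "B \<in> P" "w \<in> B"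
      using P(3) space_UNIV unfolding partition_on_def by auto
    have "indicator A w = (if A = B then 1 else 0 :: real)" if "A \<in> P" for A
      using B that P(3) by (auto simp: partition_on_def disjoint_def indicator_def)
    then have "?F w = (\<Sum>A\<in>P. if A = B then y A else 0)"
      unfolding ind_def by (intro sum.cong) auto
    then show ?thesis using B P(1) y(1) by simp
  qed
  then have pw: "norm (?F w) powr q \<le> 1 powr q" for w
    using q by (intro powr_mono2) auto
  have "(\<integral>w. norm (?F w) powr q \<partial>M) \<le> (\<integral>w. 1 \<partial>M)"
    using integrable_norm_powr[OF F, of q] q pw by (intro integral_mono) auto
  then have "(\<integral>w. norm (?F w) powr q \<partial>M) powr (1 / q) \<le> 1 powr (1 / q)"
    using q by (intro powr_mono2) (auto simp: prob_space)
  then have "Lq_norm q M ?F \<le> 1" by (simp add: Lq_norm_def)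
  from mult_left_mono[OF this \<gamma>] have "l ?F \<le> \<gamma>" using l_le[OF F] by simp
  have "(\<Sum>A\<in>P. norm (rep_measure A)) \<le> (\<Sum>A\<in>P. 2 * blinfun_apply (rep_measure A) (y A))"
    using y(2) by (intro sum_mono) (simp add: field_simps)
  also have "\<dots> = 2 * l ?F"
    using P(2) by (simp add: lF rep_measure_apply subset_iff flip: sum_distrib_left)
  also have "\<dots> \<le> 2 * \<gamma>" using \<open>l ?F \<le> \<gamma>\<close> by simp
  finally show "(\<Sum>A\<in>P. norm (rep_measure A)) \<le> 2 * \<gamma>" .
qed

end

context Lq_functional begin

lemma l_ind_sum:
  assumes "finite I" "\<And>i. i \<in> I \<Longrightarrow> D i \<in> sets M"
  shows "(\<lambda>w. \<Sum>i\<in>I. indicator (D i) w *\<^sub>R y i) \<in> bounded_strongly_measurable M"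
    and "l (\<lambda>w. \<Sum>i\<in>I. indicator (D i) w *\<^sub>R y i) = (\<Sum>i\<in>I. l (ind (D i) (y i)))"
  using l_sum[OF assms(1), of "\<lambda>i. ind (D i) (y i)"] assms ind_bounded by (auto simp: ind_def)

context
  fixes g :: "'a \<Rightarrow> 'z dual"
  assumes g: "strongly_measurable M g"
    and g_int: "integrable M (\<lambda>w. norm (g w))"
    and g_rep: "\<And>A. A \<in> sets M \<Longrightarrow> has_bochner_value M (\<lambda>w. indicator A w *\<^sub>R g w) (rep_measure A)"
begin

lemma density_ind:
  assumes A: "A \<in> sets M"
  shows "integrable M (\<lambda>w. indicator A w * blinfun_apply (g w) z)"
    and "(\<integral>w. indicator A w * blinfun_apply (g w) z \<partial>M) = l (ind A z)"
proof -
  have "has_bochner_integral M (\<lambda>w. blinfun_apply (bidual_embed z) (indicator A w *\<^sub>R g w))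
      (blinfun_apply (bidual_embed z) (rep_measure A))"
    by (rule has_bochner_value_functional[OF g_rep[OF A]])
  then have "has_bochner_integral M (\<lambda>w. indicator A w * blinfun_apply (g w) z) (l (ind A z))"
    by (simp add: bidual_embed.rep_eq blinfun.scaleR_left rep_measure_apply[OF A])
  then show "integrable M (\<lambda>w. indicator A w * blinfun_apply (g w) z)"
    and "(\<integral>w. indicator A w * blinfun_apply (g w) z \<partial>M) = l (ind A z)"
    by (auto simp: has_bochner_integral_iff)
qed

lemma density_simple:
  assumes "finite I" "\<And>i. i \<in> I \<Longrightarrow> D i \<in> sets M"
  shows "integrable M (\<lambda>w. \<Sum>i\<in>I. indicator (D i) w * blinfun_apply (g w) (y i))"
    and "(\<integral>w. (\<Sum>i\<in>I. indicator (D i) w * blinfun_apply (g w) (y i)) \<partial>M)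
      = l (\<lambda>w. \<Sum>i\<in>I. indicator (D i) w *\<^sub>R y i)"
proof -
  show "integrable M (\<lambda>w. \<Sum>i\<in>I. indicator (D i) w * blinfun_apply (g w) (y i))"
    by (intro Bochner_Integration.integrable_sum density_ind assms)
  have "(\<integral>w. (\<Sum>i\<in>I. indicator (D i) w * blinfun_apply (g w) (y i)) \<partial>M)
      = (\<Sum>i\<in>I. l (ind (D i) (y i)))"
    using assms(2) by (subst Bochner_Integration.integral_sum) (auto intro: density_ind simp: density_ind)
  then show "(\<integral>w. (\<Sum>i\<in>I. indicator (D i) w * blinfun_apply (g w) (y i)) \<partial>M)
      = l (\<lambda>w. \<Sum>i\<in>I. indicator (D i) w *\<^sub>R y i)"
    by (simp only: l_ind_sum(2)[OF assms])
qed

text \<open>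
  The heart of the estimate \<open>g \<in> L^p\<close>. The functional can be tested with step functions only, so the
  extremal choice \<open>\<parallel>g\<parallel> powr (p - 1)\<close> times a norming vector of \<open>g\<close> is made for a simple function \<open>s\<close>
  instead, on the set \<open>D\<close> where \<open>s\<close> is relatively close to \<open>g\<close>. With \<open>I\<close> the integral of
  \<open>\<parallel>s\<parallel> powr p\<close> over \<open>D\<close>, this gives \<open>I / 4 \<le> \<gamma> * I powr (1 / q)\<close>, and \<open>I\<close> is finite because \<open>s\<close> is simple.
\<close>

lemma density_test:
  assumes s: "simple_function M s"
  defines "D \<equiv> {w. norm (s w - g w) \<le> norm (g w) / 8}"
  shows "D \<in> sets M"
    and "(\<integral>\<^sup>+ w. ennreal (indicator D w * norm (s w) powr p) \<partial>M) \<le> ennreal ((4 * \<gamma>) powr p)"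
proof -
  have [measurable]: "(\<lambda>w. norm (g w)) \<in> borel_measurable M" using g_int by auto
  have [measurable]: "(\<lambda>w. norm (s w - g w)) \<in> borel_measurable M"
    by (intro borel_measurable_norm_strongly strongly_measurable_diff g strongly_measurable_simple s)
  have "{w \<in> space M. norm (s w - g w) \<le> norm (g w) / 8} \<in> sets M" by measurable
  then show D: "D \<in> sets M" by (simp add: D_def space_UNIV)
  define V where "V = range s"
  have V: "finite V" using s by (auto simp: simple_function_def V_def space_UNIV)
  define Dv where "Dv v = D \<inter> (s -` {v})" for v
  have Dv: "Dv v \<in> sets M" for v
    using D simple_functionD(2)[OF s, of "{v}"] by (auto simp: Dv_def space_UNIV)
  obtain y where y: "\<And>v :: 'z dual. norm (y v) \<le> 1" "\<And>v. norm v / 2 \<le> blinfun_apply v (y v)"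
    using norming_vector by metis
  define c where "c v = norm v powr (p - 1) *\<^sub>R y v" for v
  let ?F = "\<lambda>w. \<Sum>v\<in>V. indicator (Dv v) w *\<^sub>R c v"
  have F: "?F \<in> bounded_strongly_measurable M" by (rule l_ind_sum(1)[OF V Dv])
  have collapse: "(\<Sum>v\<in>V. indicator (Dv v) w *\<^sub>R h v) = indicator D w *\<^sub>R h (s w)" for w and h :: "'z dual \<Rightarrow> 'b::real_vector"
  proof -
    have "(\<Sum>v\<in>V. indicator (Dv v) w *\<^sub>R h v) = (\<Sum>v\<in>V. if v = s w then indicator D w *\<^sub>R h v else 0)"
      by (intro sum.cong) (auto simp: Dv_def indicator_def)
    then show ?thesis using V by (simp add: V_def)
  qed
  have normF: "norm (?F w) powr q \<le> indicator D w * norm (s w) powr p" for w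
  proof -
    have "norm (?F w) \<le> indicator D w * norm (s w) powr (p - 1)"
      unfolding collapse using y(1)[of "s w"] by (auto simp: c_def indicator_def intro: mult_left_le)
    then have "norm (?F w) powr q \<le> (indicator D w * norm (s w) powr (p - 1)) powr q"
      using q by (intro powr_mono2) auto
    also have "\<dots> = indicator D w * norm (s w) powr p"
      using conjugate q by (auto simp: indicator_def powr_powr)
    finally show ?thesis .
  qed
  have lower: "indicator D w * norm (s w) powr p / 4 \<le> (\<Sum>v\<in>V. indicator (Dv v) w * blinfun_apply (g w) (c v))" for w
  proof (cases "w \<in> D")
    case True
    let ?v = "s w"
    have close: "norm (?v - g w) \<le> norm (g w) / 8" using True by (simp add: D_def)
    have "norm (g w) \<le> norm ?v + norm (?v - g w)"
      using norm_triangle_ineq4[of ?v "?v - g w"] by simp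
    \<comment> \<open>The norming vector retains half of the norm of \<open>s w\<close> and the distance costs a quarter of it.\<close>
    then have dist: "norm (?v - g w) \<le> norm ?v / 4" using close norm_ge_zero[of ?v] by linarith
    have "blinfun_apply (?v - g w) (y ?v) \<le> norm (?v - g w) * norm (y ?v)"
      using norm_blinfun[of "?v - g w" "y ?v"] by simp
    also have "\<dots> \<le> norm (?v - g w)" using y(1)[of ?v] by (intro mult_left_le) auto
    finally have "norm ?v / 4 \<le> blinfun_apply (g w) (y ?v)"
      using y(2)[of ?v] dist by (simp add: blinfun.diff_left)
    then have "norm ?v powr (p - 1) * (norm ?v / 4) \<le> norm ?v powr (p - 1) * blinfun_apply (g w) (y ?v)"
      by (intro mult_left_mono) auto
    moreover have "norm ?v powr (p - 1) * norm ?v = norm ?v powr p"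
      by (cases "?v = 0") (auto simp: powr_diff)
    ultimately show ?thesis
      using collapse[of w "\<lambda>v. blinfun_apply (g w) (c v)"] True
      by (simp add: c_def blinfun.scaleR_right)
  next
    case False
    then have "indicator (Dv v) w = (0::real)" for v by (simp add: Dv_def)
    then show ?thesis using False by simp
  qed
  have meas: "(\<lambda>w. indicator D w * norm (s w) powr p) \<in> borel_measurable M"
  proof -
    have "(\<lambda>w. norm (s w)) \<in> borel_measurable M"
      by (intro borel_measurable_norm_strongly strongly_measurable_simple s)
    then show ?thesis using D by measurable
  qed
  have int: "integrable M (\<lambda>w. indicator D w * norm (s w) powr p)"
  proof (rule integrable_const_bound)
    show "AE w in M. norm (indicator D w * norm (s w) powr p) \<le> (\<Sum>v\<in>V. norm v powr p)"
      using V by (intro AE_I2) (auto simp: indicator_def V_def intro!: member_le_sum sum_nonneg)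
  qed (rule meas)
  define I where "I = (\<integral>w. indicator D w * norm (s w) powr p \<partial>M)"
  have "I \<ge> 0" by (simp add: I_def)
  have "I / 4 = (\<integral>w. indicator D w * norm (s w) powr p / 4 \<partial>M)" by (simp add: I_def)
  also have "\<dots> \<le> (\<integral>w. (\<Sum>v\<in>V. indicator (Dv v) w * blinfun_apply (g w) (c v)) \<partial>M)"
    by (intro integral_mono lower density_simple(1)[OF V Dv]) (use int in simp)
  also have "\<dots> = l ?F" by (rule density_simple(2)[OF V Dv])
  also have "\<dots> \<le> \<gamma> * Lq_norm q M ?F" by (rule l_le[OF F])
  also have "\<dots> \<le> \<gamma> * I powr (1 / q)"
  proof (rule mult_left_mono[OF _ \<gamma>])
    have "(\<integral>w. norm (?F w) powr q \<partial>M) \<le> I"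
      unfolding I_def using q by (intro integral_mono normF int integrable_norm_powr[OF F]) auto
    then show "Lq_norm q M ?F \<le> I powr (1 / q)"
      unfolding Lq_norm_def using q by (intro powr_mono2) auto
  qed
  finally have I4: "I / 4 \<le> \<gamma> * I powr (1 / q)" .
  have "I \<le> (4 * \<gamma>) powr p"
  proof (cases "I = 0")
    case False
    then have "I > 0" using \<open>I \<ge> 0\<close> by simp
    have "I powr (1 / p) * I powr (1 / q) = I"
      using \<open>I > 0\<close> pq by (simp flip: powr_add)
    then have "I powr (1 / p) * I powr (1 / q) \<le> (4 * \<gamma>) * I powr (1 / q)" using I4 by simp
    then have "I powr (1 / p) \<le> 4 * \<gamma>" using \<open>I > 0\<close> by simp
    then have "(I powr (1 / p)) powr p \<le> (4 * \<gamma>) powr p"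
      using p by (intro powr_mono2) auto
    then show ?thesis using p \<open>I > 0\<close> by (simp add: powr_powr)
  qed simp
  then show "(\<integral>\<^sup>+ w. ennreal (indicator D w * norm (s w) powr p) \<partial>M) \<le> ennreal ((4 * \<gamma>) powr p)"
    using int by (subst nn_integral_eq_integral) (auto simp: I_def intro: ennreal_leI)
qed

text \<open>
  Almost every point with \<open>g w \<noteq> 0\<close> lies in all but finitely many of the sets of the preceding
  estimate, and on them \<open>\<parallel>g\<parallel> \<le> 2 \<parallel>s\<parallel>\<close>; Fatou's lemma concludes.
\<close>

lemma density_Lp: "g \<in> bochner_Lp p M"
proof -
  obtain s where s: "\<And>n. simple_function M (s n)" "AE w in M. (\<lambda>n. s n w) \<longlonglongrightarrow> g w"
    using g by (auto simp: strongly_measurable_def)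
  define D where "D n = {w. norm (s n w - g w) \<le> norm (g w) / 8}" for n
  have [measurable]: "(\<lambda>w. norm (g w)) \<in> borel_measurable M" using g_int by auto
  have [measurable]: "D n \<in> sets M" for n unfolding D_def by (rule density_test(1)[OF s(1)])
  have [measurable]: "(\<lambda>w. norm (s n w)) \<in> borel_measurable M" for n
    by (intro borel_measurable_norm_strongly strongly_measurable_simple s)
  define h where "h n w = indicator (D n) w * norm (g w) powr p" for n w
  have [measurable]: "h n \<in> borel_measurable M" for n unfolding h_def by measurable
  define C where "C = ennreal (2 powr p) * ennreal ((4 * \<gamma>) powr p)"
  have "(\<integral>\<^sup>+ w. ennreal (h n w) \<partial>M) \<le> C" for n
  proof -
    have "h n w \<le> 2 powr p * (indicator (D n) w * norm (s n w) powr p)" for w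
    proof (cases "w \<in> D n")
      case True
      have "norm (g w) \<le> norm (s n w) + norm (s n w - g w)"
        using norm_triangle_ineq4[of "s n w" "s n w - g w"] by simp
      then have "norm (g w) \<le> 2 * norm (s n w)" using True norm_ge_zero[of "s n w"]
        unfolding D_def mem_Collect_eq by linarith
      then have "norm (g w) powr p \<le> (2 * norm (s n w)) powr p"
        using p by (intro powr_mono2) auto
      then show ?thesis using True by (simp add: h_def powr_mult)
    qed (simp add: h_def)
    then have "(\<integral>\<^sup>+ w. ennreal (h n w) \<partial>M)
      \<le> (\<integral>\<^sup>+ w. ennreal (2 powr p) * ennreal (indicator (D n) w * norm (s n w) powr p) \<partial>M)"
      by (intro nn_integral_mono) (auto simp flip: ennreal_mult intro!: ennreal_leI)
    also have "\<dots> = ennreal (2 powr p) * (\<integral>\<^sup>+ w. ennreal (indicator (D n) w * norm (s n w) powr p) \<partial>M)"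
      by (rule nn_integral_cmult) measurable
    also have "\<dots> \<le> C"
      unfolding C_def D_def by (intro mult_left_mono density_test(2)[OF s(1)]) simp
    finally show ?thesis .
  qed
  note hC = this
  have lim: "AE w in M. (\<lambda>n. h n w) \<longlonglongrightarrow> norm (g w) powr p"
    using s(2)
  proof eventually_elim
    case (elim w)
    show ?case
    proof (cases "g w = 0")
      case False
      from tendsto_norm[OF tendsto_diff[OF elim tendsto_const[of "g w"]]]
      have "(\<lambda>n. norm (s n w - g w)) \<longlonglongrightarrow> 0" by simp
      then have "eventually (\<lambda>n. norm (s n w - g w) < norm (g w) / 8) sequentially"
        by (rule order_tendstoD(2)) (use False in simp)
      then have "eventually (\<lambda>n. norm (g w) powr p = h n w) sequentially"
        by eventually_elim (simp add: h_def D_def)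
      then show ?thesis by (rule Lim_transform_eventually[OF tendsto_const])
    qed (use p in \<open>simp add: h_def\<close>)
  qed
  have "(\<integral>\<^sup>+ w. ennreal (norm (g w) powr p) \<partial>M) = (\<integral>\<^sup>+ w. liminf (\<lambda>n. ennreal (h n w)) \<partial>M)"
    using lim by (intro nn_integral_cong_AE)
      (auto elim!: eventually_mono intro!: lim_imp_Liminf[symmetric] tendsto_ennrealI)
  also have "\<dots> \<le> liminf (\<lambda>n. \<integral>\<^sup>+ w. ennreal (h n w) \<partial>M)"
    by (rule nn_integral_liminf) measurable
  also have "\<dots> \<le> liminf (\<lambda>n. C)" by (intro Liminf_mono always_eventually) (use hC in auto)
  also have "\<dots> = C" by (simp add: Liminf_const)
  also have "\<dots> < \<infinity>" by (simp add: C_def ennreal_mult_less_top)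
  finally have "integrable M (\<lambda>w. norm (g w) powr p)"
    by (intro integrableI_nonneg) auto
  then show ?thesis using g by (simp add: bochner_Lp_def)
qed

text \<open>
  Both sides are continuous under the dominated approximation of \<open>f\<close> by simple functions: the left
  one by the \<open>L^q\<close> bound, the right one because \<open>g\<close> is integrable.
\<close>

lemma density_bounded:
  assumes f: "f \<in> borel_measurable M" and c: "\<And>w. \<bar>f w\<bar> \<le> c"
  shows "l (\<lambda>w. f w *\<^sub>R z) = (\<integral>w. f w * blinfun_apply (g w) z \<partial>M)"
proof -
  obtain s where s: "\<And>n. simple_function M (s n)" "\<And>w. (\<lambda>n. s n w) \<longlonglongrightarrow> f w"
    "\<And>n w. \<bar>s n w\<bar> \<le> 2 * \<bar>f w\<bar>"
    using borel_measurable_implies_sequence_metric[OF f, of 0] by (auto simp: space_UNIV)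
  have s_meas [measurable]: "s n \<in> borel_measurable M" for n by (rule borel_measurable_simple_function[OF s(1)])
  note f [measurable]
  have bnd: "\<bar>s n w\<bar> \<le> 2 * c" for n w using s(3)[of n w] c[of w] by simp
  have bnd3: "\<bar>f w - s n w\<bar> \<le> 3 * c" for n w using bnd[of n w] c[of w] by linarith
  have gz [measurable]: "(\<lambda>w. blinfun_apply (g w) z) \<in> borel_measurable M"
    by (intro strongly_measurable_real strongly_measurable_blinfun_apply g strongly_measurable_const)
  have eq: "l (\<lambda>w. s n w *\<^sub>R z) = (\<integral>w. s n w * blinfun_apply (g w) z \<partial>M)" for n
  proof -
    have V: "finite (range (s n))" using s(1)[of n] by (auto simp: simple_function_def space_UNIV)
    have D: "s n -` {v} \<in> sets M" for v
      using simple_functionD(2)[OF s(1)[of n], of "{v}"] by (simp add: space_UNIV)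
    have rep: "(\<Sum>v\<in>range (s n). indicator (s n -` {v}) w *\<^sub>R h v) = h (s n w)" for w and h :: "real \<Rightarrow> 'b::real_vector"
    proof -
      have "(\<Sum>v\<in>range (s n). indicator (s n -` {v}) w *\<^sub>R h v) = (\<Sum>v\<in>range (s n). if v = s n w then h v else 0)"
        by (intro sum.cong) (auto simp: indicator_def)
      then show ?thesis using V by simp
    qed
    have "(\<integral>w. (\<Sum>v\<in>range (s n). indicator (s n -` {v}) w * blinfun_apply (g w) (v *\<^sub>R z)) \<partial>M)
      = l (\<lambda>w. \<Sum>v\<in>range (s n). indicator (s n -` {v}) w *\<^sub>R v *\<^sub>R z)"
      by (rule density_simple(2)[OF V D])
    moreover have "(\<Sum>v\<in>range (s n). indicator (s n -` {v}) w * blinfun_apply (g w) (v *\<^sub>R z))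
        = s n w * blinfun_apply (g w) z" for w
      using rep[of w "\<lambda>v. blinfun_apply (g w) (v *\<^sub>R z)"] by (simp add: blinfun.scaleR_right)
    ultimately show ?thesis by (simp only: rep)
  qed
  have "(\<lambda>n. \<integral>w. s n w * blinfun_apply (g w) z \<partial>M) \<longlonglongrightarrow> (\<integral>w. f w * blinfun_apply (g w) z \<partial>M)"
  proof (rule integral_dominated_convergence[where w="\<lambda>w. 2 * c * norm z * norm (g w)"])
    show "AE w in M. (\<lambda>n. s n w * blinfun_apply (g w) z) \<longlonglongrightarrow> f w * blinfun_apply (g w) z"
      using s(2) by (intro AE_I2 tendsto_mult_right)
    show "AE w in M. norm (s n w * blinfun_apply (g w) z) \<le> 2 * c * norm z * norm (g w)" for n
    proof (intro AE_I2)
      fix w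
      have "\<bar>s n w\<bar> * \<bar>blinfun_apply (g w) z\<bar> \<le> (2 * c) * (norm (g w) * norm z)"
        using bnd[of n w] norm_blinfun[of "g w" z] by (intro mult_mono) auto
      then show "norm (s n w * blinfun_apply (g w) z) \<le> 2 * c * norm z * norm (g w)"
        by (simp add: abs_mult mult_ac)
    qed
  qed (use g_int in auto)
  moreover have "(\<lambda>n. l (\<lambda>w. s n w *\<^sub>R z)) \<longlonglongrightarrow> l (\<lambda>w. f w *\<^sub>R z)"
  proof -
    have int: "integrable M (\<lambda>w. \<bar>f w - s n w\<bar> powr q)" for n
    proof (rule integrable_const_bound)
      show "AE w in M. norm (\<bar>f w - s n w\<bar> powr q) \<le> (3 * c) powr q"
        using q bnd3 by (intro AE_I2) (auto intro: powr_mono2)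
    qed measurable
    have "(\<lambda>n. \<integral>w. \<bar>f w - s n w\<bar> powr q \<partial>M) \<longlonglongrightarrow> (\<integral>w. 0 \<partial>M)"
    proof (rule integral_dominated_convergence[where w="\<lambda>w. (3 * c) powr q"])
      show "AE w in M. (\<lambda>n. \<bar>f w - s n w\<bar> powr q) \<longlonglongrightarrow> 0"
      proof (intro AE_I2)
        fix w
        have "(\<lambda>n. \<bar>f w - s n w\<bar> powr q) \<longlonglongrightarrow> \<bar>f w - f w\<bar> powr q"
          using q by (intro tendsto_powr' tendsto_intros s(2)) auto
        then show "(\<lambda>n. \<bar>f w - s n w\<bar> powr q) \<longlonglongrightarrow> 0" by simp
      qed
      show "AE w in M. norm (\<bar>f w - s n w\<bar> powr q) \<le> (3 * c) powr q" for n
        using q bnd3 by (intro AE_I2) (auto intro: powr_mono2)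
    qed auto
    then have "(\<lambda>n. (\<integral>w. \<bar>f w - s n w\<bar> powr q \<partial>M) powr (1 / q)) \<longlonglongrightarrow> 0 powr (1 / q)"
      using q by (intro tendsto_powr') auto
    then have null: "(\<lambda>n. \<gamma> * (norm z * (\<integral>w. \<bar>f w - s n w\<bar> powr q \<partial>M) powr (1 / q))) \<longlonglongrightarrow> 0"
      by (intro tendsto_mult_right_zero) simp
    have "\<bar>l (\<lambda>w. f w *\<^sub>R z) - l (\<lambda>w. s n w *\<^sub>R z)\<bar>
      \<le> \<gamma> * (norm z * (\<integral>w. \<bar>f w - s n w\<bar> powr q \<partial>M) powr (1 / q))" for n
    proof -
      have sB: "(\<lambda>w. s n w *\<^sub>R z) \<in> bounded_strongly_measurable M"
        by (rule bounded_strongly_measurable_scaleR[OF s_meas bnd])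
      have dB: "(\<lambda>w. (f w - s n w) *\<^sub>R z) \<in> bounded_strongly_measurable M"
        by (rule bounded_strongly_measurable_scaleR[OF _ bnd3]) measurable
      have "(\<lambda>w. f w *\<^sub>R z) = (\<lambda>w. (f w - s n w) *\<^sub>R z) + (\<lambda>w. s n w *\<^sub>R z)"
        by (simp add: fun_eq_iff algebra_simps)
      then have "l (\<lambda>w. f w *\<^sub>R z) - l (\<lambda>w. s n w *\<^sub>R z) = l (\<lambda>w. (f w - s n w) *\<^sub>R z)"
        using l_add[OF dB sB] by simp
      moreover have "Lq_norm q M (\<lambda>w. (f w - s n w) *\<^sub>R z) = norm z * (\<integral>w. \<bar>f w - s n w\<bar> powr q \<partial>M) powr (1 / q)"
        using q by (simp add: Lq_norm_def powr_mult powr_powr mult.commute)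
      ultimately show ?thesis using l_abs[OF dB] by simp
    qed
    then have "(\<lambda>n. l (\<lambda>w. f w *\<^sub>R z) - l (\<lambda>w. s n w *\<^sub>R z)) \<longlonglongrightarrow> 0"
      by (intro Lim_null_comparison[OF _ null]) auto
    from tendsto_diff[OF tendsto_const[of "l (\<lambda>w. f w *\<^sub>R z)"] this] show ?thesis by simp
  qed
  ultimately show ?thesis unfolding eq by (rule LIMSEQ_unique[rotated])
qed

end

theorem Lq_functional_density:
  assumes "radon_nikodym_property M TYPE('z dual)"
  shows "\<exists>g \<in> bochner_Lp p M. \<forall>f z c. f \<in> borel_measurable M \<longrightarrow> (\<forall>w. \<bar>f w\<bar> \<le> c) \<longrightarrow>
    l (\<lambda>w. f w *\<^sub>R z) = (\<integral>w. f w * blinfun_apply (g w) z \<partial>M)"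
proof -
  obtain g where g: "g \<in> bochner_Lp 1 M"
    "\<And>A. A \<in> sets M \<Longrightarrow> has_bochner_value M (\<lambda>w. indicator A w *\<^sub>R g w) (rep_measure A)"
    using assms rep_measure_countably_additive rep_measure_bounded_variation rep_measure_abs_continuous
    unfolding radon_nikodym_property_def by blast
  then have "strongly_measurable M g" "integrable M (\<lambda>w. norm (g w))"
    by (auto simp: bochner_Lp_def)
  from density_Lp[OF this g(2)] density_bounded[OF this g(2)] show ?thesis by blast
qed

end

section \<open>Orthonormal families in the dual of Wiener space\<close>

text \<open>
  The representing vector minimises \<open>Q x = x \<bullet> x - 2 f x\<close>. By the parallelogram law every minimising
  sequence is Cauchy.
\<close>

lemma riesz_representation:
  fixes f :: "'h::{real_inner, complete_space} \<Rightarrow> real"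
  assumes "bounded_linear f"
  shows "\<exists>h. \<forall>k. h \<bullet> k = f k"
proof -
  interpret f: bounded_linear f by fact
  obtain K where K: "\<And>x. norm (f x) \<le> norm x * K" using f.bounded by blast
  define Q where "Q x = x \<bullet> x - 2 * f x" for x
  have "- (K * K) \<le> Q x" for x
  proof -
    have "0 \<le> (norm x - K) * (norm x - K)" by simp
    then have "- (K * K) \<le> norm x * norm x - 2 * (norm x * K)" by (simp add: algebra_simps)
    also have "\<dots> \<le> Q x" using K[of x] by (simp add: Q_def power2_norm_eq_inner[symmetric] power2_eq_square)
    finally show ?thesis .
  qed
  then have bdd: "bdd_below (range Q)" by (intro bdd_belowI2)
  define m where "m = Inf (range Q)"
  have m: "m \<le> Q x" for x unfolding m_def by (intro cInf_lower bdd) simp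
  have "\<exists>x. Q x < m + inverse (real (Suc n))" for n
  proof -
    have "Inf (range Q) < m + inverse (real (Suc n))" by (simp add: m_def)
    then show ?thesis using cInf_lessD[of "range Q"] by auto
  qed
  then obtain x where x: "\<And>n. Q (x n) < m + inverse (real (Suc n))" by metis
  have para: "(norm (a - b))\<^sup>2 = 2 * Q a + 2 * Q b - 4 * Q ((1/2) *\<^sub>R (a + b))" for a b
    unfolding Q_def by (simp add: power2_norm_eq_inner f.scaleR f.add inner_simps inner_commute algebra_simps)
  have close: "(norm (x i - x j))\<^sup>2 \<le> 4 * inverse (real (Suc n))" if "n \<le> i" "n \<le> j" for n i j
  proof -
    have "inverse (real (Suc i)) \<le> inverse (real (Suc n))" "inverse (real (Suc j)) \<le> inverse (real (Suc n))"
      using that by (auto intro!: le_imp_inverse_le)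
    then show ?thesis
      using para[of "x i" "x j"] x[of i] x[of j] m[of "(1/2) *\<^sub>R (x i + x j)"] by linarith
  qed
  have "Cauchy x"
  proof (rule metric_CauchyI)
    fix e :: real assume "e > 0"
    then obtain N where N: "inverse (real (Suc N)) < e\<^sup>2 / 4"
      using reals_Archimedean[of "e\<^sup>2 / 4"] by auto
    have "dist (x i) (x j) < e" if "N \<le> i" "N \<le> j" for i j
    proof -
      have "(norm (x i - x j))\<^sup>2 < e\<^sup>2" using close[OF that] N by simp
      then show ?thesis using \<open>e > 0\<close> by (simp add: dist_norm power2_less_imp_less)
    qed
    then show "\<exists>N. \<forall>i\<ge>N. \<forall>j\<ge>N. dist (x i) (x j) < e" by blast
  qed
  then obtain h where h: "x \<longlonglongrightarrow> h" using Cauchy_convergent_iff convergent_def by blast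
  have "(\<lambda>n. Q (x n)) \<longlonglongrightarrow> Q h"
    unfolding Q_def by (intro tendsto_intros h f.tendsto)
  moreover have "(\<lambda>n. m + inverse (real (Suc n))) \<longlonglongrightarrow> m + 0"
    by (intro tendsto_add tendsto_const LIMSEQ_inverse_real_of_nat)
  ultimately have "Q h \<le> m + 0"
    by (rule LIMSEQ_le) (use x less_imp_le in blast)
  then have min: "Q h \<le> Q y" for y using m[of y] by simp
  have "h \<bullet> k = f k" for k
  proof (rule ccontr)
    assume "h \<bullet> k \<noteq> f k"
    \<comment> \<open>The minimising \<open>t\<close> is \<open>- a / (k \<bullet> k)\<close>; adding 1 to the denominator keeps it positive.\<close>
    define a where "a = h \<bullet> k - f k"
    define b where "b = k \<bullet> k + 1"
    have "a \<noteq> 0" "b \<ge> 1" using \<open>h \<bullet> k \<noteq> f k\<close> by (auto simp: a_def b_def)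
    have expand: "Q (h + t *\<^sub>R k) - Q h = 2 * t * a + t * t * (b - 1)" for t
      by (simp add: Q_def a_def b_def f.add f.scaleR inner_simps inner_commute algebra_simps)
    have "0 \<le> 2 * (- a / b) * a + (- a / b) * (- a / b) * (b - 1)"
      using min[of "h + (- a / b) *\<^sub>R k"] expand[of "- a / b"] by linarith
    also have "\<dots> = - (a * a * (b + 1)) / (b * b)"
      using \<open>b \<ge> 1\<close> by (simp add: field_simps)
    also have "\<dots> < 0" using \<open>a \<noteq> 0\<close> \<open>b \<ge> 1\<close> by (intro divide_neg_pos) (auto simp: zero_less_mult_iff less_le)
    finally show False by simp
  qed
  then show ?thesis by blast
qed

lemma dual_to_H_inner:
  fixes \<iota> :: "'h::{real_inner, complete_space} \<Rightarrow>\<^sub>L 'w::real_normed_vector"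
  shows "dual_to_H \<iota> e \<bullet> k = blinfun_apply e (blinfun_apply \<iota> k)"
proof -
  have "bounded_linear (\<lambda>k. blinfun_apply e (blinfun_apply \<iota> k))"
    by (rule bounded_linear_compose[OF blinfun.bounded_linear_right blinfun.bounded_linear_right])
  then obtain h where h: "\<forall>k. h \<bullet> k = blinfun_apply e (blinfun_apply \<iota> k)"
    using riesz_representation by blast
  have "\<forall>k. dual_to_H \<iota> e \<bullet> k = blinfun_apply e (blinfun_apply \<iota> k)"
    unfolding dual_to_H_def
  proof (rule theI[where P="\<lambda>h. \<forall>k. h \<bullet> k = blinfun_apply e (blinfun_apply \<iota> k)", OF h])
    show "h' = h" if "\<forall>k. h' \<bullet> k = blinfun_apply e (blinfun_apply \<iota> k)" for h'
      using that h by (metis vector_eq_rdot inner_commute)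
  qed
  then show ?thesis by blast
qed

lemma linear_dual_to_H:
  fixes \<iota> :: "'h::{real_inner, complete_space} \<Rightarrow>\<^sub>L 'w::real_normed_vector"
  shows "linear (dual_to_H \<iota>)"
proof
  show "dual_to_H \<iota> (a + b) = dual_to_H \<iota> a + dual_to_H \<iota> b" for a b
    by (subst vector_eq_rdot[symmetric]) (simp add: inner_add_left dual_to_H_inner blinfun.add_left)
  show "dual_to_H \<iota> (c *\<^sub>R a) = c *\<^sub>R dual_to_H \<iota> a" for c a
    by (subst vector_eq_rdot[symmetric]) (simp add: dual_to_H_inner blinfun.scaleR_left)
qed

definition H_orthonormal ::
  "('h::real_inner \<Rightarrow>\<^sub>L 'w::real_normed_vector) \<Rightarrow> nat \<Rightarrow> (nat \<Rightarrow> 'w dual) \<Rightarrow> bool" where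
  "H_orthonormal \<iota> m e \<longleftrightarrow>
     (\<forall>i<m. \<forall>k<m. dual_to_H \<iota> (e i) \<bullet> dual_to_H \<iota> (e k) = (if i = k then 1 else 0))"

context abstract_wiener_space
begin

text \<open>
  A functional that vanishes on the dense image of \<open>H\<close> is zero. Hence the Gram--Schmidt process in \<open>H\<close>
  can be lifted to the dual of \<open>W\<close>.
\<close>

lemma dual_to_H_eq_0:
  assumes "dual_to_H \<iota> e = 0" shows "e = 0"
proof (rule blinfun_eqI)
  fix w
  have "range (blinfun_apply \<iota>) \<subseteq> {w. blinfun_apply e w = 0}"
    using dual_to_H_inner[of \<iota> e] assms by auto
  moreover have "closed {w. blinfun_apply e w = 0}"
    by (intro closed_Collect_eq continuous_intros)
  ultimately have "closure (range (blinfun_apply \<iota>)) \<subseteq> {w. blinfun_apply e w = 0}"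
    by (rule closure_minimal)
  then show "blinfun_apply e w = blinfun_apply 0 w" using dense_embedding by auto
qed

text \<open>
  One Gram--Schmidt step. If \<open>f\<close> already lies in the span, the family stays as it is, which is why the
  new length is not determined.
\<close>

lemma H_orthonormal_extend1:
  assumes e: "H_orthonormal \<iota> m e"
  shows "\<exists>m' e' t. H_orthonormal \<iota> m' e' \<and> m \<le> m' \<and> (\<forall>i<m. e' i = e i) \<and> f = (\<Sum>i<m'. t i *\<^sub>R e' i)"
proof -
  interpret J: linear "dual_to_H \<iota>" by (rule linear_dual_to_H)
  let ?J = "dual_to_H \<iota>"
  define t where "t i = ?J f \<bullet> ?J (e i)" for i
  define h where "h = f - (\<Sum>i<m. t i *\<^sub>R e i)"
  have orth: "?J h \<bullet> ?J (e k) = 0" if "k < m" for k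
  proof -
    have "?J h \<bullet> ?J (e k) = t k - (\<Sum>i<m. t i * (?J (e i) \<bullet> ?J (e k)))"
      by (simp add: h_def J.diff J.sum J.scale inner_diff_left inner_sum_left t_def)
    also have "(\<Sum>i<m. t i * (?J (e i) \<bullet> ?J (e k))) = (\<Sum>i<m. if i = k then t k else 0)"
      using e that by (intro sum.cong) (auto simp: H_orthonormal_def)
    also have "\<dots> = t k" using that by simp
    finally show ?thesis by simp
  qed
  show ?thesis
  proof (cases "?J h = 0")
    case True
    then have "h = 0" by (rule dual_to_H_eq_0)
    then have "f = (\<Sum>i<m. t i *\<^sub>R e i)" by (simp add: h_def)
    then show ?thesis using e by blast
  next
    case False
    define e' where "e' = e(m := (1 / norm (?J h)) *\<^sub>R h)"
    define t' where "t' = t(m := norm (?J h))"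
    have JJ: "?J h \<bullet> ?J h = norm (?J h) * norm (?J h)"
      by (simp add: dot_square_norm power2_eq_square)
    have "H_orthonormal \<iota> (Suc m) e'"
      unfolding H_orthonormal_def
    proof (intro allI impI)
      fix i k assume "i < Suc m" "k < Suc m"
      then show "?J (e' i) \<bullet> ?J (e' k) = (if i = k then 1 else 0)"
        using e orth False
        by (auto simp: e'_def H_orthonormal_def J.scale less_Suc_eq inner_commute[of "?J (e _)" "?J h"]
            JJ)
    qed
    moreover have "f = (\<Sum>i<Suc m. t' i *\<^sub>R e' i)"
    proof -
      have "(\<Sum>i<m. t' i *\<^sub>R e' i) = (\<Sum>i<m. t i *\<^sub>R e i)"
        by (intro sum.cong) (auto simp: t'_def e'_def)
      then show ?thesis using False by (simp add: t'_def e'_def h_def)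
    qed
    ultimately show ?thesis
      by (intro exI[of _ "Suc m"] exI[of _ e'] exI[of _ t']) (auto simp: e'_def)
  qed
qed

lemma H_orthonormal_extend:
  fixes n :: nat
  assumes e: "H_orthonormal \<iota> m e"
  shows "\<exists>m' e'. H_orthonormal \<iota> m' e' \<and> m \<le> m' \<and> (\<forall>i<m. e' i = e i) \<and>
    (\<forall>j<n. \<exists>t. f j = (\<Sum>i<m'. t i *\<^sub>R e' i))"
proof (induction n)
  case 0
  then show ?case using e by blast
next
  case (Suc n)
  then obtain m' e' where 1: "H_orthonormal \<iota> m' e'" "m \<le> m'" "\<forall>i<m. e' i = e i"
    "\<forall>j<n. \<exists>t. f j = (\<Sum>i<m'. t i *\<^sub>R e' i)" by blast
  obtain m'' e'' t where 2: "H_orthonormal \<iota> m'' e''" "m' \<le> m''" "\<forall>i<m'. e'' i = e' i"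
    "f n = (\<Sum>i<m''. t i *\<^sub>R e'' i)" using H_orthonormal_extend1[OF 1(1), of "f n"] by blast
  have "\<exists>t. f j = (\<Sum>i<m''. t i *\<^sub>R e'' i)" if j: "j < Suc n" for j
  proof (cases "j = n")
    case False
    then obtain t where "f j = (\<Sum>i<m'. t i *\<^sub>R e' i)" using 1(4) j by (auto simp: less_Suc_eq)
    also have "\<dots> = (\<Sum>i<m'. (if i < m' then t i else 0) *\<^sub>R e'' i)" using 2(3) by (intro sum.cong) auto
    also have "\<dots> = (\<Sum>i<m''. (if i < m' then t i else 0) *\<^sub>R e'' i)"
      using 2(2) by (intro sum.mono_neutral_left) auto
    finally show ?thesis by (intro exI[of _ "\<lambda>i. if i < m' then t i else 0"])
  qed (use 2(4) in blast)
  then show ?case using 1 2 by (intro exI[of _ m''] exI[of _ e'']) auto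
qed

text \<open>
  Two cylindrical random variables need not be given in terms of the same functionals. This common
  family is what makes their sum cylindrical.
\<close>

lemma common_orthonormal:
  assumes "H_orthonormal \<iota> m e" "H_orthonormal \<iota> m1 e1"
  shows "\<exists>m' e' A B. H_orthonormal \<iota> m' e' \<and> (\<forall>i<m. e i = (\<Sum>k<m'. A i k *\<^sub>R e' k)) \<and>
    (\<forall>i<m1. e1 i = (\<Sum>k<m'. B i k *\<^sub>R e' k))"
proof -
  obtain m' e' where 1: "H_orthonormal \<iota> m' e'" "m \<le> m'" "\<forall>i<m. e' i = e i"
    "\<forall>j<m1. \<exists>t. e1 j = (\<Sum>i<m'. t i *\<^sub>R e' i)"
    using H_orthonormal_extend[OF assms(1), of m1 e1] by blast
  have "e i = (\<Sum>k<m'. (if k = i then 1 else 0) *\<^sub>R e' k)" if "i < m" for i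
    using 1(2,3) that by (simp add: if_distrib[of "\<lambda>c. c *\<^sub>R _"] cong: if_cong)
  moreover obtain B where "\<And>j. j < m1 \<Longrightarrow> e1 j = (\<Sum>i<m'. B j i *\<^sub>R e' i)"
    using 1(4) by metis
  ultimately show ?thesis
    using 1(1) by (intro exI[of _ m'] exI[of _ e'] exI[of _ "\<lambda>i k. if k = i then 1 else 0"] exI[of _ B]) auto
qed

end

section \<open>Smooth functions and linear substitutions\<close>

lemma tendsto_funI:
  fixes f :: "'a \<Rightarrow> 'i \<Rightarrow> 'b::topological_space"
  assumes "\<And>i. ((\<lambda>t. f t i) \<longlongrightarrow> l i) F"
  shows "(f \<longlongrightarrow> l) F"
proof -
  have "limitin (product_topology (\<lambda>i. euclidean) UNIV) f l F"
    using assms by (simp add: limitin_componentwise)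
  then show ?thesis by (simp add: euclidean_product_topology)
qed

definition cyl_dep :: "nat \<Rightarrow> ((nat \<Rightarrow> real) \<Rightarrow> real) \<Rightarrow> bool" where
  "cyl_dep m \<phi> \<longleftrightarrow> (\<forall>x y. (\<forall>i<m. x i = y i) \<longrightarrow> \<phi> x = \<phi> y)"

definition partially_differentiable :: "nat \<Rightarrow> ((nat \<Rightarrow> real) \<Rightarrow> real) \<Rightarrow> bool" where
  "partially_differentiable m \<phi> \<longleftrightarrow> (\<forall>i<m. \<forall>x. (\<lambda>t. \<phi> (x(i := t))) differentiable at (x i))"

lemma Cb_infinity_iff:
  "\<phi> \<in> Cb_infinity m \<longleftrightarrow> cyl_dep m \<phi> \<and> (\<forall>is\<in>lists {..<m}.
     continuous_on UNIV (foldr partial_deriv is \<phi>) \<and> (\<exists>C. \<forall>x. \<bar>foldr partial_deriv is \<phi> x\<bar> \<le> C) \<and>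
     partially_differentiable m (foldr partial_deriv is \<phi>))"
  by (simp add: Cb_infinity_def cyl_dep_def partially_differentiable_def Let_def)

lemma Cb_infinityD:
  assumes "\<phi> \<in> Cb_infinity m"
  shows "cyl_dep m \<phi>" "continuous_on UNIV \<phi>" "\<exists>C. \<forall>x. \<bar>\<phi> x\<bar> \<le> C" "partially_differentiable m \<phi>"
proof -
  have "[] \<in> lists {..<m}" by simp
  then have "continuous_on UNIV (foldr partial_deriv [] \<phi>) \<and> (\<exists>C. \<forall>x. \<bar>foldr partial_deriv [] \<phi> x\<bar> \<le> C) \<and>
     partially_differentiable m (foldr partial_deriv [] \<phi>)"
    using assms unfolding Cb_infinity_iff by blast
  then show "continuous_on UNIV \<phi>" "\<exists>C. \<forall>x. \<bar>\<phi> x\<bar> \<le> C" "partially_differentiable m \<phi>"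
    by simp_all
  show "cyl_dep m \<phi>" using assms by (simp add: Cb_infinity_iff)
qed

lemma cyl_dep_partial_deriv:
  assumes "cyl_dep m \<phi>" "i < m" shows "cyl_dep m (partial_deriv i \<phi>)"
  unfolding cyl_dep_def
proof (intro allI impI)
  fix x y :: "nat \<Rightarrow> real" assume xy: "\<forall>i<m. x i = y i"
  have "\<phi> (x(i := t)) = \<phi> (y(i := t))" for t
    using assms xy by (simp add: cyl_dep_def)
  then show "partial_deriv i \<phi> x = partial_deriv i \<phi> y"
    using xy assms(2) by (simp add: partial_deriv_def)
qed

lemma partial_deriv_Cb_infinity:
  assumes \<phi>: "\<phi> \<in> Cb_infinity m" and i: "i < m"
  shows "partial_deriv i \<phi> \<in> Cb_infinity m"
  unfolding Cb_infinity_iff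
proof (intro conjI ballI)
  show "cyl_dep m (partial_deriv i \<phi>)" by (rule cyl_dep_partial_deriv[OF Cb_infinityD(1)[OF \<phi>] i])
  fix js assume "js \<in> lists {..<m}"
  then have "js @ [i] \<in> lists {..<m}" using i by auto
  then have *: "continuous_on UNIV (foldr partial_deriv (js @ [i]) \<phi>) \<and>
     (\<exists>C. \<forall>x. \<bar>foldr partial_deriv (js @ [i]) \<phi> x\<bar> \<le> C) \<and>
     partially_differentiable m (foldr partial_deriv (js @ [i]) \<phi>)"
    using \<phi> unfolding Cb_infinity_iff by blast
  show "continuous_on UNIV (foldr partial_deriv js (partial_deriv i \<phi>))"
    and "\<exists>C. \<forall>x. \<bar>foldr partial_deriv js (partial_deriv i \<phi>) x\<bar> \<le> C"
    and "partially_differentiable m (foldr partial_deriv js (partial_deriv i \<phi>))"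
    using * by auto
qed

text \<open>
  To see that all iterated derivatives behave well, it is enough to exhibit a class of well-behaved
  functions that is closed under partial derivatives.
\<close>

lemma Cb_infinity_coinduct:
  assumes "\<phi> \<in> G" and G: "\<And>\<psi>. \<psi> \<in> G \<Longrightarrow> cyl_dep m \<psi> \<and> continuous_on UNIV \<psi> \<and> (\<exists>C. \<forall>x. \<bar>\<psi> x\<bar> \<le> C) \<and>
      partially_differentiable m \<psi>"
    and step: "\<And>\<psi> i. \<psi> \<in> G \<Longrightarrow> i < m \<Longrightarrow> partial_deriv i \<psi> \<in> G"
  shows "\<phi> \<in> Cb_infinity m"
proof -
  have "foldr partial_deriv is \<phi> \<in> G" if "is \<in> lists {..<m}" for "is"
    using that by (induction "is") (auto intro: step \<open>\<phi> \<in> G\<close>)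
  then show ?thesis unfolding Cb_infinity_iff using G \<open>\<phi> \<in> G\<close> by blast
qed

lemma partial_has_derivative:
  assumes "partially_differentiable m \<phi>" "i < m"
  shows "((\<lambda>t. \<phi> (x(i := t))) has_real_derivative partial_deriv i \<phi> (x(i := s))) (at s)"
proof -
  have "(\<lambda>t. \<phi> ((x(i := s))(i := t))) differentiable at ((x(i := s)) i)"
    using assms unfolding partially_differentiable_def by blast
  then have "(\<lambda>t. \<phi> (x(i := t))) differentiable at s" by simp
  then have "((\<lambda>t. \<phi> (x(i := t))) has_real_derivative deriv (\<lambda>t. \<phi> (x(i := t))) s) (at s)"
    by (simp add: DERIV_deriv_iff_real_differentiable)
  then show ?thesis by (simp add: partial_deriv_def)
qed

lemma partial_mean_value:
  assumes "partially_differentiable m \<phi>" "i < m"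
  shows "\<exists>\<xi>. \<bar>\<xi> - a\<bar> \<le> \<bar>b - a\<bar> \<and>
    \<phi> (x(i := b)) - \<phi> (x(i := a)) = (b - a) * partial_deriv i \<phi> (x(i := \<xi>))"
proof (cases a b rule: linorder_cases)
  case less
  from MVT2[OF this partial_has_derivative[OF assms]]
  obtain z where "a < z" "z < b" "\<phi> (x(i := b)) - \<phi> (x(i := a)) = (b - a) * partial_deriv i \<phi> (x(i := z))"
    by blast
  then show ?thesis by (intro exI[of _ z]) auto
next
  case greater
  from MVT2[OF this partial_has_derivative[OF assms]]
  obtain z where "b < z" "z < a" "\<phi> (x(i := a)) - \<phi> (x(i := b)) = (a - b) * partial_deriv i \<phi> (x(i := z))"
    by blast
  then show ?thesis by (intro exI[of _ z]) (auto simp: algebra_simps)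
qed auto

text \<open>
  The chain rule along a line, for continuous partial derivatives. The increment is the telescoping sum
  of increments in one coordinate at a time, each of which is evaluated by the mean value theorem at
  a point that tends to \<open>x\<close> coordinatewise.
\<close>

lemma directional_derivative:
  assumes dep: "cyl_dep m \<phi>" and diff: "partially_differentiable m \<phi>"
    and cont: "\<And>i. i < m \<Longrightarrow> continuous_on UNIV (partial_deriv i \<phi>)"
  shows "((\<lambda>t. \<phi> (\<lambda>i. x i + t * v i)) has_real_derivative (\<Sum>i<m. v i * partial_deriv i \<phi> x)) (at 0)"
proof -
  define y where "y j t = (\<lambda>i. if i < j then x i + t * v i else x i)" for j :: nat and t
  have "\<exists>\<xi>. \<bar>\<xi> - x j\<bar> \<le> \<bar>t * v j\<bar> \<and>
    \<phi> (y (Suc j) t) - \<phi> (y j t) = t * v j * partial_deriv j \<phi> ((y j t)(j := \<xi>))" if "j < m" for j t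
  proof -
    have "y (Suc j) t = (y j t)(j := x j + t * v j)" "y j t = (y j t)(j := x j)"
      by (auto simp: y_def fun_eq_iff less_Suc_eq)
    then show ?thesis
      using partial_mean_value[OF diff that, of "x j" "x j + t * v j" "y j t"] by simp
  qed
  then obtain \<xi> where \<xi>: "\<And>j t. j < m \<Longrightarrow> \<bar>\<xi> j t - x j\<bar> \<le> \<bar>t * v j\<bar>"
    "\<And>j t. j < m \<Longrightarrow> \<phi> (y (Suc j) t) - \<phi> (y j t) = t * v j * partial_deriv j \<phi> ((y j t)(j := \<xi> j t))"
    by metis
  have quotient: "(\<phi> (\<lambda>i. x i + t * v i) - \<phi> x) / t = (\<Sum>j<m. v j * partial_deriv j \<phi> ((y j t)(j := \<xi> j t)))"
    if "t \<noteq> 0" for t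
  proof -
    have "\<phi> (\<lambda>i. x i + t * v i) = \<phi> (y m t)"
      using dep by (simp add: cyl_dep_def y_def)
    moreover have "y 0 t = x" by (simp add: y_def)
    moreover have "(\<Sum>j<m. \<phi> (y (Suc j) t) - \<phi> (y j t)) = \<phi> (y m t) - \<phi> (y 0 t)"
      by (rule sum_lessThan_telescope)
    ultimately have "\<phi> (\<lambda>i. x i + t * v i) - \<phi> x = (\<Sum>j<m. \<phi> (y (Suc j) t) - \<phi> (y j t))"
      by simp
    also have "\<dots> = t * (\<Sum>j<m. v j * partial_deriv j \<phi> ((y j t)(j := \<xi> j t)))"
      by (simp add: \<xi>(2) sum_distrib_left mult_ac)
    finally show ?thesis using that by simp
  qed
  have "((\<lambda>t. \<Sum>j<m. v j * partial_deriv j \<phi> ((y j t)(j := \<xi> j t))) \<longlongrightarrow> (\<Sum>i<m. v i * partial_deriv i \<phi> x)) (at 0)"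
  proof (intro tendsto_intros)
    fix j assume "j \<in> {..<m}"
    then have j: "j < m" by simp
    have null: "((\<lambda>t. t * c) \<longlongrightarrow> 0) (at 0)" for c :: real
      by (intro tendsto_mult_left_zero tendsto_ident_at)
    have "((\<lambda>t. (y j t)(j := \<xi> j t)) \<longlongrightarrow> x) (at 0)"
    proof (rule tendsto_funI)
      fix i
      show "((\<lambda>t. ((y j t)(j := \<xi> j t)) i) \<longlongrightarrow> x i) (at 0)"
      proof (cases "i = j")
        case True
        have "((\<lambda>t. \<xi> j t - x j) \<longlongrightarrow> 0) (at 0)"
          by (rule Lim_null_comparison[OF _ tendsto_rabs_zero[OF null[of "v j"]]]) (use \<xi>(1)[OF j] in auto)
        then show ?thesis using True by (simp add: LIM_zero_iff)
      next
        case False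
        have "((\<lambda>t. x i + t * v i) \<longlongrightarrow> x i + 0) (at 0)" by (intro tendsto_intros null)
        then show ?thesis using False by (cases "i < j") (simp_all add: y_def)
      qed
    qed
    moreover have "isCont (partial_deriv j \<phi>) x"
      using cont[OF j] by (simp add: continuous_on_eq_continuous_at)
    ultimately show "((\<lambda>t. partial_deriv j \<phi> ((y j t)(j := \<xi> j t))) \<longlongrightarrow> partial_deriv j \<phi> x) (at 0)"
      using isCont_tendsto_compose by blast
  qed
  then show ?thesis
    unfolding DERIV_def
    by (rule Lim_transform_eventually) (auto simp: eventually_at_filter quotient intro!: always_eventually)
qed

text \<open>
  The coordinates from \<open>m\<close> on are irrelevant for functions on \<open>\<real>\<^sup>m\<close>; the value 0 is an arbitrary choice.
\<close>

definition lin_subst :: "nat \<Rightarrow> nat \<Rightarrow> (nat \<Rightarrow> nat \<Rightarrow> real) \<Rightarrow> (nat \<Rightarrow> real) \<Rightarrow> nat \<Rightarrow> real" where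
  "lin_subst m m' A x = (\<lambda>i. if i < m then \<Sum>k<m'. A i k * x k else 0)"

lemma lin_subst_deriv:
  assumes \<phi>: "\<phi> \<in> Cb_infinity m" and k: "k < m'"
  shows "((\<lambda>t. \<phi> (lin_subst m m' A (x(k := t)))) has_real_derivative
      (\<Sum>i<m. A i k * partial_deriv i \<phi> (lin_subst m m' A x))) (at (x k))"
proof -
  let ?L = "lin_subst m m' A"
  let ?v = "\<lambda>i. if i < m then A i k else 0"
  have line: "?L (x(k := x k + t)) = (\<lambda>i. ?L x i + t * ?v i)" for t
  proof
    fix i
    have "(\<Sum>k'<m'. A i k' * (x(k := x k + t)) k') = (\<Sum>k'<m'. A i k' * x k' + (if k' = k then A i k * t else 0))"
      by (intro sum.cong) (auto simp: algebra_simps)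
    then show "?L (x(k := x k + t)) i = ?L x i + t * ?v i"
      using k by (simp add: lin_subst_def sum.distrib mult.commute)
  qed
  have "((\<lambda>t. \<phi> (\<lambda>i. ?L x i + t * ?v i)) has_real_derivative (\<Sum>i<m. ?v i * partial_deriv i \<phi> (?L x))) (at 0)"
    by (intro directional_derivative Cb_infinityD[OF \<phi>] Cb_infinityD(2)[OF partial_deriv_Cb_infinity[OF \<phi>]])
  then have "((\<lambda>t. \<phi> (?L (x(k := x k + t)))) has_real_derivative (\<Sum>i<m. A i k * partial_deriv i \<phi> (?L x))) (at 0)"
    by (simp add: line)
  then show ?thesis
    using DERIV_shift[of "\<lambda>t. \<phi> (?L (x(k := t)))" _ 0 "x k"] by (simp add: add.commute)
qed

lemma partial_deriv_lin_subst:
  assumes "\<phi> \<in> Cb_infinity m" "k < m'"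
  shows "partial_deriv k (\<lambda>x. \<phi> (lin_subst m m' A x)) x = (\<Sum>i<m. A i k * partial_deriv i \<phi> (lin_subst m m' A x))"
  unfolding partial_deriv_def[of k "\<lambda>x. \<phi> (lin_subst m m' A x)"]
  by (rule DERIV_imp_deriv[OF lin_subst_deriv[OF assms]])

text \<open>
  The derivative of \<open>\<psi> \<circ> L\<close> is a linear combination of functions of the same form, so the span of these
  functions is the class to which coinduction applies.
\<close>

inductive_set subst_span :: "nat \<Rightarrow> nat \<Rightarrow> (nat \<Rightarrow> nat \<Rightarrow> real) \<Rightarrow> ((nat \<Rightarrow> real) \<Rightarrow> real) set"
  for m m' A where
  zero: "(\<lambda>x. 0) \<in> subst_span m m' A"
| step: "\<psi> \<in> Cb_infinity m \<Longrightarrow> F \<in> subst_span m m' A \<Longrightarrow>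
    (\<lambda>x. a * \<psi> (lin_subst m m' A x) + F x) \<in> subst_span m m' A"

lemma subst_span_sum:
  assumes "finite I" "F \<in> subst_span m m' A" "\<And>i. i \<in> I \<Longrightarrow> \<psi> i \<in> Cb_infinity m"
  shows "(\<lambda>x. (\<Sum>i\<in>I. c i * \<psi> i (lin_subst m m' A x)) + F x) \<in> subst_span m m' A"
  using assms
proof (induction I rule: finite_induct)
  case (insert i I)
  then have "(\<lambda>x. c i * \<psi> i (lin_subst m m' A x) + ((\<Sum>i\<in>I. c i * \<psi> i (lin_subst m m' A x)) + F x)) \<in> subst_span m m' A"
    by (intro subst_span.step) auto
  then show ?case using insert by (simp add: add.assoc)
qed simp

lemma subst_span_regular:
  assumes "F \<in> subst_span m m' A"
  shows "cyl_dep m' F \<and> continuous_on UNIV F \<and> (\<exists>C. \<forall>x. \<bar>F x\<bar> \<le> C) \<and> partially_differentiable m' F \<and>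
    (\<forall>k<m'. partial_deriv k F \<in> subst_span m m' A)"
  using assms
proof induction
  case zero
  have "partial_deriv k (\<lambda>x. 0) = (\<lambda>x. 0)" for k by (simp add: partial_deriv_def fun_eq_iff)
  then show ?case using subst_span.zero
    by (auto simp: cyl_dep_def partially_differentiable_def)
next
  case (step \<psi> F a)
  let ?L = "lin_subst m m' A"
  note \<psi> = Cb_infinityD[OF step.hyps(1)]
  have L_cont: "continuous_on UNIV ?L"
    unfolding lin_subst_def
  proof (intro continuous_on_coordinatewise_then_product)
    fix i
    show "continuous_on UNIV (\<lambda>x. if i < m then \<Sum>k<m'. A i k * x k else (0::real))"
      by (cases "i < m") (auto intro!: continuous_intros)
  qed
  have L_dep: "?L x = ?L y" if "\<forall>i<m'. x i = y i" for x y
    using that by (auto simp: lin_subst_def fun_eq_iff intro!: sum.cong)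
  have F: "cyl_dep m' F" "continuous_on UNIV F" "partially_differentiable m' F"
    "\<And>k. k < m' \<Longrightarrow> partial_deriv k F \<in> subst_span m m' A" using step.IH by auto
  obtain C D where C: "\<And>x. \<bar>\<psi> x\<bar> \<le> C" and D: "\<And>x. \<bar>F x\<bar> \<le> D" using \<psi>(3) step.IH by blast
  have der: "((\<lambda>t. a * \<psi> (?L (x(k := t))) + F (x(k := t))) has_real_derivative
      (a * (\<Sum>i<m. A i k * partial_deriv i \<psi> (?L x)) + partial_deriv k F x)) (at (x k))" if "k < m'" for k x
    using partial_has_derivative[OF F(3) that, of x "x k"]
    by (intro DERIV_add DERIV_cmult lin_subst_deriv[OF step.hyps(1) that]) simp
  have "cyl_dep m' (\<lambda>x. a * \<psi> (?L x) + F x)"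
    using F(1) L_dep unfolding cyl_dep_def by metis
  moreover have "continuous_on UNIV (\<lambda>x. a * \<psi> (?L x) + F x)"
    by (intro continuous_on_add continuous_on_mult continuous_on_const F(2)
        continuous_on_compose2[OF \<psi>(2) L_cont]) auto
  moreover have "\<bar>a * \<psi> (?L x) + F x\<bar> \<le> \<bar>a\<bar> * C + D" for x
    using mult_left_mono[OF C[of "?L x"] abs_ge_zero[of a]] D[of x]
      abs_triangle_ineq[of "a * \<psi> (?L x)" "F x"] by (simp add: abs_mult)
  moreover have "partially_differentiable m' (\<lambda>x. a * \<psi> (?L x) + F x)"
    unfolding partially_differentiable_def using der real_differentiable_def by blast
  moreover have "partial_deriv k (\<lambda>x. a * \<psi> (?L x) + F x) \<in> subst_span m m' A" if k: "k < m'" for k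
  proof -
    have "partial_deriv k (\<lambda>x. a * \<psi> (?L x) + F x)
      = (\<lambda>x. (\<Sum>i<m. (a * A i k) * partial_deriv i \<psi> (?L x)) + partial_deriv k F x)"
      unfolding partial_deriv_def[of k "\<lambda>x. a * \<psi> (?L x) + F x"]
      by (rule ext, subst DERIV_imp_deriv[OF der[OF k]]) (simp add: sum_distrib_left mult.assoc)
    then show ?thesis
      using subst_span_sum[OF _ F(4)[OF k], of "{..<m}" "\<lambda>i. partial_deriv i \<psi>" "\<lambda>i. a * A i k"]
        partial_deriv_Cb_infinity[OF step.hyps(1)] by simp
  qed
  ultimately show ?case by blast
qed

lemma lin_subst_Cb_infinity:
  assumes "\<phi> \<in> Cb_infinity m"
  shows "(\<lambda>x. \<phi> (lin_subst m m' A x)) \<in> Cb_infinity m'"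
proof (rule Cb_infinity_coinduct[of _ "subst_span m m' A"])
  show "(\<lambda>x. \<phi> (lin_subst m m' A x)) \<in> subst_span m m' A"
    using subst_span.step[OF assms subst_span.zero[of m m' A], of 1] by simp
qed (use subst_span_regular in blast)+

section \<open>Cylindrical random variables\<close>

lemma smooth_cyl_iff:
  "Cyl m n e \<phi> z \<in> smooth_cyl \<iota> \<longleftrightarrow> H_orthonormal \<iota> m e \<and> (\<forall>j<n. \<phi> j \<in> Cb_infinity m)"
  by (auto simp: smooth_cyl_def H_orthonormal_def)

lemma lin_subst_eval:
  assumes "\<phi> \<in> Cb_infinity m" "\<And>i. i < m \<Longrightarrow> e i = (\<Sum>k<m'. A i k *\<^sub>R e' k)"
  shows "\<phi> (lin_subst m m' A (\<lambda>k. blinfun_apply (e' k) w)) = \<phi> (\<lambda>i. blinfun_apply (e i) w)"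
  using Cb_infinityD(1)[OF assms(1)] assms(2)
  by (simp add: cyl_dep_def lin_subst_def blinfun.sum_left blinfun.scaleR_left)

text \<open>
  Invariance of the trace under a change of the representation: the matrix \<open>A\<close> that the chain rule
  produces is absorbed into the functionals, by linearity of \<open>T\<close>.
\<close>

lemma lin_subst_trace:
  fixes h :: "'x::real_normed_vector dual" and T :: "'w::real_normed_vector dual \<Rightarrow>\<^sub>L 'x"
  assumes \<phi>: "\<phi> \<in> Cb_infinity m" and e: "\<And>i. i < m \<Longrightarrow> e i = (\<Sum>k<m'. A i k *\<^sub>R e' k)"
  shows "(\<Sum>k<m'. partial_deriv k (\<lambda>x. \<phi> (lin_subst m m' A x)) (\<lambda>k. blinfun_apply (e' k) w) * blinfun_apply h (blinfun_apply T (e' k)))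
    = (\<Sum>i<m. partial_deriv i \<phi> (\<lambda>i. blinfun_apply (e i) w) * blinfun_apply h (blinfun_apply T (e i)))"
proof -
  let ?E = "\<lambda>k. blinfun_apply (e' k) w" and ?h = "\<lambda>f. blinfun_apply h (blinfun_apply T f)"
  have "(\<Sum>k<m'. partial_deriv k (\<lambda>x. \<phi> (lin_subst m m' A x)) ?E * ?h (e' k))
    = (\<Sum>k<m'. \<Sum>i<m. A i k * partial_deriv i \<phi> (lin_subst m m' A ?E) * ?h (e' k))"
    by (simp add: partial_deriv_lin_subst[OF \<phi>] sum_distrib_right)
  also have "\<dots> = (\<Sum>i<m. \<Sum>k<m'. A i k * partial_deriv i \<phi> (lin_subst m m' A ?E) * ?h (e' k))"
    by (rule sum.swap)
  also have "\<dots> = (\<Sum>i<m. partial_deriv i \<phi> (\<lambda>i. blinfun_apply (e i) w) * ?h (e i))"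
  proof (intro sum.cong refl)
    fix i assume "i \<in> {..<m}"
    then have i: "i < m" by simp
    have "?h (e i) = (\<Sum>k<m'. A i k * ?h (e' k))"
      using e[OF i] by (simp add: blinfun.sum_right blinfun.scaleR_right)
    then show "(\<Sum>k<m'. A i k * partial_deriv i \<phi> (lin_subst m m' A ?E) * ?h (e' k))
      = partial_deriv i \<phi> (\<lambda>i. blinfun_apply (e i) w) * ?h (e i)"
      using lin_subst_eval[where \<phi>="partial_deriv i \<phi>", OF partial_deriv_Cb_infinity[OF \<phi> i] e]
      by (simp add: sum_distrib_left mult_ac)
  qed
  finally show ?thesis .
qed

lemma sum_append:
  fixes a b :: "nat \<Rightarrow> 'a::comm_monoid_add"
  shows "(\<Sum>j<n + n1. if j < n then a j else b (j - n)) = (\<Sum>j<n. a j) + (\<Sum>j<n1. b j)"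
  by (induction n1) (auto simp: add.assoc)

text \<open>
  Both summands are rewritten in terms of a common orthonormal family. The map \<open>h\<close> is carried along
  because the traces occur for test functions composed with the canonical embedding into the bidual.
\<close>

lemma (in abstract_wiener_space) smooth_cyl_add:
  fixes F G :: "('w dual, 'z::real_normed_vector) cyl"
  assumes "F \<in> smooth_cyl \<iota>" "G \<in> smooth_cyl \<iota>"
  shows "\<exists>S \<in> smooth_cyl \<iota>. (\<forall>w. cyl_rv S w = cyl_rv F w + cyl_rv G w) \<and>
    (\<forall>(h :: 'z \<Rightarrow> 'x::real_normed_vector dual) T w. tr_grad T (map_cyl id h S) w =
      tr_grad T (map_cyl id h F) w + tr_grad T (map_cyl id h G) w)"
proof -
  obtain m n e \<phi> z where F: "F = Cyl m n e \<phi> z" by (cases F)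
  obtain m1 n1 e1 \<phi>1 z1 where G: "G = Cyl m1 n1 e1 \<phi>1 z1" by (cases G)
  have e: "H_orthonormal \<iota> m e" "\<And>j. j < n \<Longrightarrow> \<phi> j \<in> Cb_infinity m"
    and e1: "H_orthonormal \<iota> m1 e1" "\<And>j. j < n1 \<Longrightarrow> \<phi>1 j \<in> Cb_infinity m1"
    using assms by (auto simp: F G smooth_cyl_iff)
  obtain m' e' A B where e': "H_orthonormal \<iota> m' e'"
    and AB: "\<forall>i<m. e i = (\<Sum>k<m'. A i k *\<^sub>R e' k)" "\<forall>i<m1. e1 i = (\<Sum>k<m'. B i k *\<^sub>R e' k)"
    using common_orthonormal[OF e(1) e1(1)] by (elim exE conjE)
  have A: "e i = (\<Sum>k<m'. A i k *\<^sub>R e' k)" if "i < m" for i using AB(1) that by simp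
  have B: "e1 i = (\<Sum>k<m'. B i k *\<^sub>R e' k)" if "i < m1" for i using AB(2) that by simp
  define \<psi> where "\<psi> j = (if j < n then (\<lambda>x. \<phi> j (lin_subst m m' A x))
    else (\<lambda>x. \<phi>1 (j - n) (lin_subst m1 m' B x)))" for j
  define v where "v j = (if j < n then z j else z1 (j - n))" for j
  define S where "S = Cyl m' (n + n1) e' \<psi> v"
  have "S \<in> smooth_cyl \<iota>"
    using e' e(2) e1(2) by (auto simp: S_def smooth_cyl_iff \<psi>_def intro!: lin_subst_Cb_infinity)
  moreover have "cyl_rv S w = cyl_rv F w + cyl_rv G w" for w
  proof -
    have "cyl_rv S w = (\<Sum>j<n + n1. if j < n then \<phi> j (lin_subst m m' A (\<lambda>k. blinfun_apply (e' k) w)) *\<^sub>R z j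
      else \<phi>1 (j - n) (lin_subst m1 m' B (\<lambda>k. blinfun_apply (e' k) w)) *\<^sub>R z1 (j - n))"
      by (auto simp: S_def \<psi>_def v_def intro!: sum.cong)
    also have "\<dots> = cyl_rv F w + cyl_rv G w"
      by (subst sum_append) (simp add: F G lin_subst_eval[OF e(2) A] lin_subst_eval[OF e1(2) B])
    finally show ?thesis .
  qed
  moreover have "tr_grad T (map_cyl id h S) w = tr_grad T (map_cyl id h F) w + tr_grad T (map_cyl id h G) w"
    for T and h :: "'z \<Rightarrow> 'x dual" and w
  proof -
    have "tr_grad T (map_cyl id h S) w = (\<Sum>j<n + n1.
      if j < n then (\<Sum>k<m'. partial_deriv k (\<lambda>x. \<phi> j (lin_subst m m' A x)) (\<lambda>k. blinfun_apply (e' k) w) * blinfun_apply (h (z j)) (blinfun_apply T (e' k)))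
      else (\<Sum>k<m'. partial_deriv k (\<lambda>x. \<phi>1 (j - n) (lin_subst m1 m' B x)) (\<lambda>k. blinfun_apply (e' k) w) * blinfun_apply (h (z1 (j - n))) (blinfun_apply T (e' k))))"
      by (auto simp: S_def \<psi>_def v_def intro!: sum.cong)
    also have "\<dots> = tr_grad T (map_cyl id h F) w + tr_grad T (map_cyl id h G) w"
      by (subst sum_append) (simp add: F G lin_subst_trace[OF e(2) A] lin_subst_trace[OF e1(2) B])
    finally show ?thesis .
  qed
  ultimately show ?thesis by blast
qed

lemma sum_fun_apply: "(\<Sum>i\<in>I. F i) x = (\<Sum>i\<in>I. F i x)"
  for F :: "'i \<Rightarrow> 'a \<Rightarrow> 'b::ab_group_add"
  by (induction I rule: infinite_finite_induct) auto

fun cyl_scale :: "real \<Rightarrow> ('e, 'z::real_vector) cyl \<Rightarrow> ('e, 'z) cyl" where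
  "cyl_scale c (Cyl m n e \<phi> z) = Cyl m n e \<phi> (\<lambda>j. c *\<^sub>R z j)"

lemma cyl_scale_smooth: "F \<in> smooth_cyl \<iota> \<Longrightarrow> cyl_scale c F \<in> smooth_cyl \<iota>"
  by (cases F) (simp add: smooth_cyl_iff)

lemma cyl_rv_scale: "cyl_rv (cyl_scale c F) w = c *\<^sub>R cyl_rv F w"
  by (cases F) (simp add: scaleR_sum_right mult.commute)

lemma tr_grad_scale:
  "tr_grad T (map_cyl id bidual_embed (cyl_scale c F)) w = c * tr_grad T (map_cyl id bidual_embed F) w"
  by (cases F) (simp add: bidual_embed.rep_eq blinfun.scaleR_right sum_distrib_left mult_ac)

lemma (in complete_prob_space) bochner_Lp_integrable_norm:
  assumes "f \<in> bochner_Lp p M" "p \<ge> 1"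
  shows "integrable M (\<lambda>w. norm (f w))"
proof (rule Bochner_Integration.integrable_bound)
  show "integrable M (\<lambda>w. 1 + norm (f w) powr p)" using assms by (simp add: bochner_Lp_def)
  show "(\<lambda>w. norm (f w)) \<in> borel_measurable M"
    using assms by (intro borel_measurable_norm_strongly) (simp add: bochner_Lp_def)
  have "t \<le> 1 + t powr p" if "t \<ge> 0" for t :: real
  proof (cases "t \<le> 1")
    case False
    then have "t powr 1 \<le> t powr p" using assms(2) by (intro powr_mono) auto
    then show ?thesis using False by simp
  qed (simp add: add_increasing2)
  then show "AE w in M. norm (norm (f w)) \<le> norm (1 + norm (f w) powr p)" by simp
qed

lemma (in complete_prob_space) integrable_functional:
  fixes f :: "'a \<Rightarrow> 'x::real_normed_vector" and \<psi> :: "'x dual"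
  assumes "strongly_measurable M f" "integrable M (\<lambda>w. norm (f w))"
  shows "integrable M (\<lambda>w. blinfun_apply \<psi> (f w))"
proof (rule Bochner_Integration.integrable_bound)
  show "integrable M (\<lambda>w. norm \<psi> * norm (f w))" using assms(2) by simp
  show "(\<lambda>w. blinfun_apply \<psi> (f w)) \<in> borel_measurable M"
    by (intro strongly_measurable_real strongly_measurable_blinfun_apply strongly_measurable_const assms)
  show "AE w in M. norm (blinfun_apply \<psi> (f w)) \<le> norm (norm \<psi> * norm (f w))"
    by (intro AE_I2) (use norm_blinfun[of \<psi>] in auto)
qed

context abstract_wiener_space
begin

lemma complete_prob_space_completion: "complete_prob_space (completion \<mu>)"
  by (simp add: complete_prob_space_def prob_space_completion completion.complete_measure_axioms)

lemma space_completion_UNIV: "space (completion \<mu>) = UNIV"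
  using sets_eq_imp_space_eq[OF sets_borel] by simp

lemma cyl_measurable:
  assumes "\<phi> \<in> Cb_infinity m"
  shows "(\<lambda>w. \<phi> (\<lambda>i. blinfun_apply (e i) w)) \<in> borel_measurable (completion \<mu>)"
proof -
  have "continuous_on UNIV (\<lambda>w. \<phi> (\<lambda>i. blinfun_apply (e i) w))"
    by (intro continuous_on_compose2[OF Cb_infinityD(2)[OF assms]]
        continuous_on_coordinatewise_then_product continuous_intros) auto
  then have "(\<lambda>w. \<phi> (\<lambda>i. blinfun_apply (e i) w)) \<in> borel_measurable borel"
    by (rule borel_measurable_continuous_onI)
  then have "(\<lambda>w. \<phi> (\<lambda>i. blinfun_apply (e i) w)) \<in> borel_measurable \<mu>"
    by (simp cong: measurable_cong_sets add: measurable_cong_sets[OF sets_borel refl])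
  then show ?thesis by (rule measurable_completion)
qed

lemma cyl_rv_bounded:
  assumes "F \<in> smooth_cyl \<iota>"
  shows "cyl_rv F \<in> bounded_strongly_measurable (completion \<mu>)"
proof -
  obtain m n e \<phi> z where F: "F = Cyl m n e \<phi> z" by (cases F)
  have "(\<Sum>j\<in>J. (\<lambda>w. \<phi> j (\<lambda>i. blinfun_apply (e i) w) *\<^sub>R z j)) \<in> bounded_strongly_measurable (completion \<mu>)"
    if "J \<subseteq> {..<n}" for J
  proof (rule subspace_sum[OF subspace_bounded_strongly_measurable])
    fix j assume "j \<in> J"
    then have \<phi>: "\<phi> j \<in> Cb_infinity m" using that assms by (auto simp: F smooth_cyl_iff)
    then obtain C where "\<And>x. \<bar>\<phi> j x\<bar> \<le> C" using Cb_infinityD(3) by blast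
    then show "(\<lambda>w. \<phi> j (\<lambda>i. blinfun_apply (e i) w) *\<^sub>R z j) \<in> bounded_strongly_measurable (completion \<mu>)"
      by (intro bounded_strongly_measurable_scaleR[where c=C] cyl_measurable[OF \<phi>])
  qed
  moreover have "cyl_rv F = (\<Sum>j<n. (\<lambda>w. \<phi> j (\<lambda>i. blinfun_apply (e i) w) *\<^sub>R z j))"
    by (rule ext) (simp add: F sum_fun_apply)
  ultimately show ?thesis by simp
qed

text \<open>
  The vector \<open>S w\<close> is the part of the trace that does not involve the vector \<open>z\<close> of a cylindrical
  random variable \<open>\<phi>(\<delta>(e)) z\<close>; the trace itself is \<open>\<langle>S w, z\<rangle>\<close>.
\<close>

lemma trace_strongly_measurable:
  fixes K :: "'w \<Rightarrow> 'w dual \<Rightarrow>\<^sub>L 'x::real_normed_vector" and e :: "nat \<Rightarrow> 'w dual"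
  assumes K: "K \<in> bochner_Lp p (completion \<mu>)" "p \<ge> 1" and \<phi>: "\<phi> \<in> Cb_infinity m"
  defines "S \<equiv> \<lambda>w. \<Sum>i<m. partial_deriv i \<phi> (\<lambda>k. blinfun_apply (e k) w) *\<^sub>R blinfun_apply (K w) (e i)"
  shows "strongly_measurable (completion \<mu>) S" "integrable (completion \<mu>) (\<lambda>w. norm (S w))"
proof -
  interpret M: complete_prob_space "completion \<mu>" by (rule complete_prob_space_completion)
  have pd: "partial_deriv i \<phi> \<in> Cb_infinity m" if "i < m" for i
    by (rule partial_deriv_Cb_infinity[OF \<phi> that])
  show S: "strongly_measurable (completion \<mu>) S"
    unfolding S_def
    by (intro strongly_measurable_sum strongly_measurable_scaleR cyl_measurable[OF pd]
        strongly_measurable_blinfun_apply strongly_measurable_const)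
      (use K in \<open>auto simp: bochner_Lp_def\<close>)
  have "\<forall>i. \<exists>C. i < m \<longrightarrow> (\<forall>x. \<bar>partial_deriv i \<phi> x\<bar> \<le> C)"
    using Cb_infinityD(3)[OF pd] by blast
  then obtain C where C: "\<And>i x. i < m \<Longrightarrow> \<bar>partial_deriv i \<phi> x\<bar> \<le> C i" by metis
  have bound: "norm (S w) \<le> (\<Sum>i<m. C i * norm (e i)) * norm (K w)" for w
  proof -
    have "norm (S w) \<le> (\<Sum>i<m. C i * (norm (K w) * norm (e i)))"
      unfolding S_def
      by (intro sum_norm_le) (auto intro!: mult_mono C norm_blinfun order_trans[OF abs_ge_zero C])
    then show ?thesis by (simp add: sum_distrib_left mult_ac)
  qed
  show "integrable (completion \<mu>) (\<lambda>w. norm (S w))"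
  proof (rule Bochner_Integration.integrable_bound)
    show "integrable (completion \<mu>) (\<lambda>w. (\<Sum>i<m. C i * norm (e i)) * norm (K w))"
      using M.bochner_Lp_integrable_norm[OF K] by simp
    show "(\<lambda>w. norm (S w)) \<in> borel_measurable (completion \<mu>)"
      by (rule completion.borel_measurable_norm_strongly[OF S])
    show "AE w in completion \<mu>. norm (norm (S w)) \<le> norm ((\<Sum>i<m. C i * norm (e i)) * norm (K w))"
      using bound by (intro AE_I2) (auto intro: order_trans[OF _ abs_ge_self])
  qed
qed

lemma tr_grad_integrable:
  fixes K :: "'w \<Rightarrow> 'w dual \<Rightarrow>\<^sub>L 'x::real_normed_vector" and F :: "('w dual, 'x dual) cyl"
  assumes "K \<in> bochner_Lp p (completion \<mu>)" "p \<ge> 1"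
    and "H_orthonormal \<iota> m e" "\<And>j. j < n \<Longrightarrow> \<phi> j \<in> Cb_infinity m"
  shows "integrable (completion \<mu>) (\<lambda>w. tr_grad (K w) (Cyl m n e \<phi> z) w)"
    and "(\<integral>w. tr_grad (K w) (Cyl m n e \<phi> z) w \<partial>completion \<mu>) = (\<Sum>j<n. \<integral>w. blinfun_apply (z j)
      (\<Sum>i<m. partial_deriv i (\<phi> j) (\<lambda>k. blinfun_apply (e k) w) *\<^sub>R blinfun_apply (K w) (e i)) \<partial>completion \<mu>)"
proof -
  interpret M: complete_prob_space "completion \<mu>" by (rule complete_prob_space_completion)
  have eq: "tr_grad (K w) (Cyl m n e \<phi> z) w = (\<Sum>j<n. blinfun_apply (z j)
      (\<Sum>i<m. partial_deriv i (\<phi> j) (\<lambda>k. blinfun_apply (e k) w) *\<^sub>R blinfun_apply (K w) (e i)))" for w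
    by (simp add: blinfun.sum_right blinfun.scaleR_right)
  have int: "integrable (completion \<mu>) (\<lambda>w. blinfun_apply (z j)
      (\<Sum>i<m. partial_deriv i (\<phi> j) (\<lambda>k. blinfun_apply (e k) w) *\<^sub>R blinfun_apply (K w) (e i)))" if "j < n" for j
    by (intro M.integrable_functional trace_strongly_measurable[OF assms(1,2) assms(4)[OF that]])
  show "integrable (completion \<mu>) (\<lambda>w. tr_grad (K w) (Cyl m n e \<phi> z) w)"
    unfolding eq by (intro Bochner_Integration.integrable_sum int) simp
  show "(\<integral>w. tr_grad (K w) (Cyl m n e \<phi> z) w \<partial>completion \<mu>) = (\<Sum>j<n. \<integral>w. blinfun_apply (z j)
      (\<Sum>i<m. partial_deriv i (\<phi> j) (\<lambda>k. blinfun_apply (e k) w) *\<^sub>R blinfun_apply (K w) (e i)) \<partial>completion \<mu>)"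
    unfolding eq by (intro Bochner_Integration.integral_sum int) simp
qed

end

section \<open>The divergence\<close>

theorem mainTheorem1:
  fixes \<iota> :: "'h::{real_inner, complete_space, second_countable_topology} \<Rightarrow>\<^sub>L
              'w::{banach, second_countable_topology}"
    and \<mu> :: "'w measure"
    and p q :: real
    and K :: "'w \<Rightarrow> 'w dual \<Rightarrow>\<^sub>L 'y::banach dual dual"
  assumes "abstract_wiener_space \<iota> \<mu>"
    and "1 < p"
    and "1 / p + 1 / q = 1"
    and "radon_nikodym_property (completion \<mu>) TYPE('y dual dual)"
    and "K \<in> bochner_Lp p (completion \<mu>)"
    and "\<exists>\<gamma>>0. \<forall>F :: ('w dual, 'y dual) cyl \<in> smooth_cyl \<iota>.
           \<bar>\<integral>w. tr_grad (K w) (map_cyl id bidual_embed F) w \<partial>completion \<mu>\<bar>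
             \<le> \<gamma> * (\<integral>w. norm (cyl_rv F w) powr q \<partial>completion \<mu>) powr (1 / q)"
  shows "K \<in> divergence_dom p \<iota> \<mu>"
proof -
  interpret abstract_wiener_space \<iota> \<mu> by fact
  interpret M: complete_prob_space "completion \<mu>" by (rule complete_prob_space_completion)
  note p = \<open>1 < p\<close> and K = \<open>K \<in> bochner_Lp p (completion \<mu>)\<close>
  have p1: "p \<ge> 1" using p by simp
  have "0 < 1 / p" "1 / p < 1" using p by auto
  then have "0 < 1 / q" "1 / q < 1" using assms(3) by linarith+
  then have q: "q > 1" by (simp add: divide_less_eq_1)
  let ?M = "completion \<mu>"
  let ?C = "bounded_strongly_measurable ?M :: ('w \<Rightarrow> 'y dual) set"
  define \<tau> where "\<tau> F = (\<integral>w. tr_grad (K w) (map_cyl id bidual_embed F) w \<partial>?M)"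
    for F :: "('w dual, 'y dual) cyl"
  obtain \<gamma> where "\<gamma> > 0" and bound: "\<And>F. F \<in> smooth_cyl \<iota> \<Longrightarrow> \<bar>\<tau> F\<bar> \<le> \<gamma> * Lq_norm q ?M (cyl_rv F)"
    using assms(6) unfolding \<tau>_def Lq_norm_def by blast
  have int: "integrable ?M (\<lambda>w. tr_grad (K w) (map_cyl id bidual_embed F) w)"
    if "F \<in> smooth_cyl \<iota>" for F
    using that by (cases F) (auto simp del: tr_grad.simps simp: smooth_cyl_iff intro!: tr_grad_integrable(1)[OF K p1])
  \<comment> \<open>The functional lives on representations of random variables. Passing to the cone of pairs makes it
    a functional on random variables.\<close>
  define B where "B = {(cyl_rv F, \<tau> F) | F. F \<in> smooth_cyl \<iota>}"
  have in_B: "(cyl_rv F, \<tau> F) \<in> B" if "F \<in> smooth_cyl \<iota>" for F using that by (auto simp: B_def)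
  have B_scale: "(t *\<^sub>R b, t * r) \<in> B" if br: "(b, r) \<in> B" for b r t
  proof -
    obtain F where F: "F \<in> smooth_cyl \<iota>" "b = cyl_rv F" "r = \<tau> F" using br by (auto simp: B_def)
    have "\<tau> (cyl_scale t F) = t * \<tau> F" by (simp add: \<tau>_def tr_grad_scale)
    moreover have "cyl_rv (cyl_scale t F) = t *\<^sub>R cyl_rv F"
      by (rule ext) (simp add: cyl_rv_scale scaleR_fun_def)
    ultimately show ?thesis using in_B[OF cyl_scale_smooth[OF F(1)], of t] F by simp
  qed
  have "\<exists>l. (\<forall>x\<in>?C. \<forall>y\<in>?C. l (x + y) = l x + l y) \<and> (\<forall>x\<in>?C. \<forall>c. l (c *\<^sub>R x) = c * l x) \<and>
    (\<forall>x\<in>?C. l x \<le> \<gamma> * Lq_norm q ?M x) \<and> (\<forall>(b, r)\<in>B. r \<le> l b)"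
  proof (rule hahn_banach_cone)
    show "subspace ?C" by (rule subspace_bounded_strongly_measurable)
    show "sublinear_on ?C (\<lambda>F. \<gamma> * Lq_norm q ?M F)"
      using q \<open>\<gamma> > 0\<close> by (intro M.sublinear_on_Lq_norm) auto
    have "Cyl 0 0 (\<lambda>_. 0) (\<lambda>_ _. 0) (\<lambda>_. 0) \<in> smooth_cyl \<iota>" by (simp add: smooth_cyl_iff H_orthonormal_def)
    then show "B \<noteq> {}" using in_B by blast
    show "b \<in> ?C" if "(b, r) \<in> B" for b r using that cyl_rv_bounded by (auto simp: B_def)
    show "(t *\<^sub>R b, t * r) \<in> B" if "(b, r) \<in> B" for b r t by (rule B_scale[OF that])
    show "r \<le> \<gamma> * Lq_norm q ?M b" if "(b, r) \<in> B" for b r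
      using that bound unfolding B_def by (auto intro: order_trans[OF abs_ge_self])
    show "(b + b', r + r') \<in> B" if B: "(b, r) \<in> B" "(b', r') \<in> B" for b r b' r'
    proof -
      obtain F where F: "F \<in> smooth_cyl \<iota>" "b = cyl_rv F" "r = \<tau> F" using B(1) by (auto simp: B_def)
      obtain G where G: "G \<in> smooth_cyl \<iota>" "b' = cyl_rv G" "r' = \<tau> G" using B(2) by (auto simp: B_def)
      obtain S where S: "S \<in> smooth_cyl \<iota>" "\<And>w. cyl_rv S w = cyl_rv F w + cyl_rv G w"
        "\<And>T w. tr_grad T (map_cyl id (bidual_embed :: _ \<Rightarrow> 'y dual dual dual) S) w =
          tr_grad T (map_cyl id bidual_embed F) w + tr_grad T (map_cyl id bidual_embed G) w"
        using smooth_cyl_add[OF F(1) G(1)] by blast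
      have "cyl_rv S = b + b'" using S(2) F(2) G(2) by (simp add: fun_eq_iff)
      moreover have "\<tau> S = r + r'" using int[OF F(1)] int[OF G(1)] by (simp add: \<tau>_def S(3) F(3) G(3))
      ultimately show ?thesis using in_B[OF S(1)] by simp
    qed
  qed
  then obtain l where l_add: "\<And>x y. x \<in> ?C \<Longrightarrow> y \<in> ?C \<Longrightarrow> l (x + y) = l x + l y"
    and l_scale: "\<And>x c. x \<in> ?C \<Longrightarrow> l (c *\<^sub>R x) = c * l x"
    and l_le: "\<And>x. x \<in> ?C \<Longrightarrow> l x \<le> \<gamma> * Lq_norm q ?M x"
    and l_B: "\<And>b r. (b, r) \<in> B \<Longrightarrow> r \<le> l b" by blast
  have l_\<tau>: "l (cyl_rv F) = \<tau> F" if F: "F \<in> smooth_cyl \<iota>" for F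
    using l_B[OF in_B[OF F]] l_B[OF B_scale[OF in_B[OF F], of "-1"]] l_scale[OF cyl_rv_bounded[OF F], of "-1"]
    by simp
  \<comment> \<open>The extended functional has a density \<open>g\<close>, which is the divergence of \<open>K\<close>.\<close>
  interpret Lq_functional ?M l \<gamma> p q
    by unfold_locales (use l_add l_scale l_le p assms(3) \<open>\<gamma> > 0\<close> space_completion_UNIV in auto)
  obtain g where g: "g \<in> bochner_Lp p ?M" and lg: "\<And>f z c. f \<in> borel_measurable ?M \<Longrightarrow> (\<And>w. \<bar>f w\<bar> \<le> c) \<Longrightarrow>
    l (\<lambda>w. f w *\<^sub>R z) = (\<integral>w. f w * blinfun_apply (g w) z \<partial>?M)"
    using Lq_functional_density[OF assms(4)] by blast
  have g_meas: "strongly_measurable ?M g" using g by (simp add: bochner_Lp_def)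
  have g_int: "integrable ?M (\<lambda>w. norm (g w))" by (rule M.bochner_Lp_integrable_norm[OF g p1])
  have "(\<integral>w. tr_grad (K w) F w \<partial>?M) = (\<integral>w. blinfun_apply (cyl_rv F w) (g w) \<partial>?M)"
    if F: "F \<in> smooth_cyl \<iota>" for F
  proof -
    obtain m n e \<phi> z where F_eq: "F = Cyl m n e \<phi> z" by (cases F)
    have e: "H_orthonormal \<iota> m e" and \<phi>: "\<And>j. j < n \<Longrightarrow> \<phi> j \<in> Cb_infinity m"
      using F by (auto simp: F_eq smooth_cyl_iff)
    define S where "S j w = (\<Sum>i<m. partial_deriv i (\<phi> j) (\<lambda>k. blinfun_apply (e k) w) *\<^sub>R blinfun_apply (K w) (e i))"
      for j w
    define R where "R j w = \<phi> j (\<lambda>k. blinfun_apply (e k) w) *\<^sub>R g w" for j w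
    have S: "strongly_measurable ?M (S j)" "integrable ?M (\<lambda>w. norm (S j w))" if "j < n" for j
      using trace_strongly_measurable[OF K p1 \<phi>[OF that], of e] by (simp_all add: S_def[abs_def])
    have R: "strongly_measurable ?M (R j)" "integrable ?M (\<lambda>w. norm (R j w))" if j: "j < n" for j
    proof -
      show R: "strongly_measurable ?M (R j)"
        unfolding R_def[abs_def] by (rule strongly_measurable_scaleR[OF cyl_measurable[OF \<phi>[OF j]] g_meas])
      obtain C where C: "\<And>x. \<bar>\<phi> j x\<bar> \<le> C" using Cb_infinityD(3)[OF \<phi>[OF j]] by blast
      show "integrable ?M (\<lambda>w. norm (R j w))"
      proof (rule Bochner_Integration.integrable_bound)
        show "integrable ?M (\<lambda>w. C * norm (g w))" using g_int by simp
        show "(\<lambda>w. norm (R j w)) \<in> borel_measurable ?M" by (rule completion.borel_measurable_norm_strongly[OF R])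
        show "AE w in ?M. norm (norm (R j w)) \<le> norm (C * norm (g w))"
          by (intro AE_I2) (auto simp: R_def intro!: order_trans[OF mult_right_mono[OF C] abs_ge_self])
      qed
    qed
    have "(\<integral>w. blinfun_apply (z j) (S j w) \<partial>?M) = (\<integral>w. blinfun_apply (z j) (R j w) \<partial>?M)" if j: "j < n" for j
    proof -
      have "(\<integral>w. blinfun_apply (z j) (S j w - R j w) \<partial>?M) = 0"
      \<comment> \<open>It suffices to test with vectors \<open>y\<close> of \<open>Y*\<close>, where the hypothesis on \<open>K\<close> applies.\<close>
      proof (rule M.integral_functional_eq_0)
        show D: "strongly_measurable ?M (\<lambda>w. S j w - R j w)"
          by (intro strongly_measurable_diff S R j)
        show "integrable ?M (\<lambda>w. norm (S j w - R j w))"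
        proof (rule Bochner_Integration.integrable_bound)
          show "integrable ?M (\<lambda>w. norm (S j w) + norm (R j w))" using S(2)[OF j] R(2)[OF j] by simp
          show "(\<lambda>w. norm (S j w - R j w)) \<in> borel_measurable ?M" by (rule completion.borel_measurable_norm_strongly[OF D])
        qed (auto intro!: AE_I2 norm_triangle_ineq4)
        fix y :: "'y dual"
        let ?G = "Cyl m 1 e (\<lambda>_. \<phi> j) (\<lambda>_. y)"
        have G: "?G \<in> smooth_cyl \<iota>" using e \<phi>[OF j] by (simp add: smooth_cyl_iff)
        obtain C where C: "\<And>x. \<bar>\<phi> j x\<bar> \<le> C" using Cb_infinityD(3)[OF \<phi>[OF j]] by blast
        have "cyl_rv ?G = (\<lambda>w. \<phi> j (\<lambda>k. blinfun_apply (e k) w) *\<^sub>R y)"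
          by (rule ext) simp
        then have "\<tau> ?G = (\<integral>w. \<phi> j (\<lambda>k. blinfun_apply (e k) w) * blinfun_apply (g w) y \<partial>?M)"
          using l_\<tau>[OF G] lg[OF cyl_measurable[OF \<phi>[OF j]] C, of e y] by simp
        moreover have "\<tau> ?G = (\<integral>w. blinfun_apply (S j w) y \<partial>?M)"
          by (simp add: \<tau>_def S_def bidual_embed.rep_eq blinfun.sum_left blinfun.scaleR_left)
        ultimately have "(\<integral>w. blinfun_apply (S j w) y \<partial>?M) = (\<integral>w. blinfun_apply (R j w) y \<partial>?M)"
          by (simp add: R_def blinfun.scaleR_left)
        moreover have "integrable ?M (\<lambda>w. blinfun_apply (S j w) y)" "integrable ?M (\<lambda>w. blinfun_apply (R j w) y)"
          using M.integrable_functional[OF S[OF j], of "bidual_embed y"]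
            M.integrable_functional[OF R[OF j], of "bidual_embed y"] by (simp_all add: bidual_embed.rep_eq)
        ultimately show "(\<integral>w. blinfun_apply (S j w - R j w) y \<partial>?M) = 0"
          by (simp add: blinfun.diff_left)
      qed
      then show ?thesis
        using M.integrable_functional[OF S[OF j]] M.integrable_functional[OF R[OF j]]
        by (simp add: blinfun.diff_right)
    qed
    then have "(\<integral>w. tr_grad (K w) F w \<partial>?M) = (\<Sum>j<n. \<integral>w. blinfun_apply (z j) (R j w) \<partial>?M)"
      unfolding F_eq using tr_grad_integrable(2)[OF K p1 e \<phi>] by (simp add: S_def)
    also have "\<dots> = (\<integral>w. (\<Sum>j<n. blinfun_apply (z j) (R j w)) \<partial>?M)"
      by (intro Bochner_Integration.integral_sum[symmetric] M.integrable_functional R) auto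
    also have "(\<lambda>w. \<Sum>j<n. blinfun_apply (z j) (R j w)) = (\<lambda>w. blinfun_apply (cyl_rv F w) (g w))"
      by (simp add: F_eq R_def blinfun.sum_left blinfun.scaleR_left blinfun.scaleR_right fun_eq_iff)
    finally show ?thesis .
  qed
  then show ?thesis using g K unfolding divergence_dom_def by blast
qed

end
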